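(* Let $(R(A),[\cdot_\lambda\cdot])$ be the Lie conformal algebra corresponding to a Gel'fand-Dorfman algebra $(A,\cdot,[\cdot,\cdot])$, let $\theta\in\mathbf k$, and let $\mathfrak B$ be a $\mathbf k[\partial]$-module homomorphism from $R(A)$ to $R(A)$ such that $\mathfrak B(A)\subset A$. Then $(R(A),[\cdot_\lambda\cdot],\mathfrak B)$ is a Rota-Baxter Lie conformal algebra of weight $\theta$ if and only if $(A,\cdot,[\cdot,\cdot],\mathfrak B|_A)$ is a Rota-Baxter Gel'fand-Dorfman algebra of weight $\theta$. In particular, if $(\cdot,\cdot)$ is a bilinear form on $A$ and $\omega_\lambda(\cdot,\cdot)$ is the conformal bilinear form on $R(A)$ defined by $\omega_\lambda(a,b)=(a,b)$ for all $a,b\in A$, then $(R(A),[\cdot_\lambda\cdot],\mathfrak B,\omega_\lambda(\cdot,\cdot))$ is a quadratic Rota-Baxter Lie conformal algebra of weight $\theta$ if and only if $(A,\cdot,[\cdot,\cdot],\mathfrak B|_A,(\cdot,\cdot))$ is a quadratic Rota-Baxter Gel'fand-Dorfman algebra of weight $\theta$.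
   Context: $\mathbf k$ is a field of characteristic zero; vector spaces are finite-dimensional. A Novikov algebra $(A,\cdot)$ satisfies $(a\cdot b)\cdot c-a\cdot(b\cdot c)=(b\cdot a)\cdot c-b\cdot(a\cdot c)$ and $(a\cdot b)\cdot c=(a\cdot c)\cdot b$. A Gel'fand-Dorfman algebra (GDA) $(A,\cdot,[\cdot,\cdot])$ is a Novikov algebra $(A,\cdot)$ and a Lie algebra $(A,[\cdot,\cdot])$ with $[a\cdot b,c]-[a\cdot c,b]+[a,b]\cdot c-[a,c]\cdot b-a\cdot[b,c]=0$. The corresponding Lie conformal algebra is $R(A)=\mathbf k[\partial]\otimes A$ with $[a_\lambda b]=\partial(b\cdot a)+\lambda(a\cdot b+b\cdot a)+[a,b]$ for $a,b\in A$, extended by $[\partial a_\lambda b]=-\lambda[a_\lambda b]$, $[a_\lambda\partial b]=(\lambda+\partial)[a_\lambda b]$. A Rota-Baxter GDA of weight $\theta$ is a GDA with a linear map $\mathfrak B:A\to A$ satisfying $\mathfrak B(a)\ast\mathfrak B(b)=\mathfrak B(\mathfrak B(a)\ast b+a\ast\mathfrak B(b)+\theta a\ast b)$ for both $\ast=\cdot$ and $\ast=[\cdot,\cdot]$. A quadratic GDA is a GDA with a non-degenerate symmetric bilinear form satisfying $([a,b],c)=(a,[b,c])$ and $(a\cdot b,c)=-(b,a\cdot c+c\cdot a)$. A quadratic Rota-Baxter GDA of weight $\theta$ is a Rota-Baxter GDA of weight $\theta$ whose underlying GDA is quadratic, with $(\mathfrak B(a),b)+(a,\mathfrak B(b))+\theta(a,b)=0$.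 A Rota-Baxter Lie conformal algebra of weight $\theta$ is a Lie conformal algebra $\mathcal A$ (a $\mathbf k[\partial]$-module with a $\mathbf k$-bilinear $\lambda$-bracket $[\cdot_\lambda\cdot]:\mathcal A\times\mathcal A\to\mathcal A[\lambda]$ satisfying $[\partial a_\lambda b]=-\lambda[a_\lambda b]$, $[a_\lambda\partial b]=(\lambda+\partial)[a_\lambda b]$, $[a_\lambda b]=-[b_{-\lambda-\partial}a]$, $[a_\lambda[b_\mu c]]=[[a_\lambda b]_{\lambda+\mu}c]+[b_\mu[a_\lambda c]]$) with a $\mathbf k[\partial]$-module homomorphism $\mathfrak B:\mathcal A\to\mathcal A$ with $[\mathfrak B(a)_\lambda\mathfrak B(b)]=\mathfrak B([\mathfrak B(a)_\lambda b]+[a_\lambda\mathfrak B(b)]+\theta[a_\lambda b])$. A conformal bilinear form is a $\mathbf k$-bilinear $\omega_\lambda:\mathcal A\times\mathcal A\to\mathbf k[\lambda]$ with $\omega_\lambda(\partial a,b)=-\lambda\omega_\lambda(a,b)$, $\omega_\lambda(a,\partial b)=\lambda\omega_\lambda(a,b)$; symmetric: $\omega_\lambda(a,b)=\omega_{-\lambda}(b,a)$; invariant: $\omega_\lambda([a_\mu b],c)=\omega_\mu(a,[b_{\lambda-\mu}c])$; non-degenerate: $a\mapsto\omega_\lambda(a,\cdot)$ is a $\mathbf k[\partial]$-module isomorphism from $\mathcal A$ onto $\mathcal A^{*c}=\{f:\mathcal A\to\mathbf k[\lambda]\ \mathbf k\text{-linear}: f_\lambda(\partial a)=\lambda f_\lambda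 a\}$ with $(\partial f)_\lambda=-\lambda f_\lambda$. A quadratic Rota-Baxter Lie conformal algebra of weight $\theta$ is a Rota-Baxter Lie conformal algebra of weight $\theta$ with a non-degenerate symmetric invariant conformal bilinear form with $\omega_\lambda(a,\mathfrak B(b))+\omega_\lambda(\mathfrak B(a),b)+\theta\omega_\lambda(a,b)=0$. *)

theory Defs
  imports "HOL-Computational_Algebra.Polynomial"
begin

section \<open>Bilinear maps and polynomials with coefficients in a module\<close>

definition bilinear_map ::
  "('k::field \<Rightarrow> 'a::ab_group_add \<Rightarrow> 'a) \<Rightarrow> ('k \<Rightarrow> 'b::ab_group_add \<Rightarrow> 'b) \<Rightarrow>
   ('k \<Rightarrow> 'c::ab_group_add \<Rightarrow> 'c) \<Rightarrow> ('a \<Rightarrow> 'b \<Rightarrow> 'c) \<Rightarrow> bool" where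
  "bilinear_map s1 s2 s3 f \<longleftrightarrow>
     (\<forall>x. Vector_Spaces.linear s2 s3 (f x)) \<and> (\<forall>y. Vector_Spaces.linear s1 s3 (\<lambda>x. f x y))"

text \<open>
  For a module \<open>M\<close>, the type \<open>'m poly\<close> represents \<open>M[\<lambda>]\<close>; multiplication by the
  variable is \<open>pCons 0\<close>, and a linear map of \<open>M\<close> acts on coefficients by \<open>map_poly\<close>.
  Given \<open>p = \<Sum>\<^sub>n \<lambda>\<^sup>n p\<^sub>n\<close> and an operator \<open>T\<close>, \<open>subst_op T f p\<close> is
  \<open>\<Sum>\<^sub>n T\<^sup>n (f p\<^sub>n)\<close>: the variable is replaced by (the quantity acting as) \<open>T\<close> after
  \<open>f\<close> has been applied to the coefficients.
\<close>
definition subst_op :: "('x::comm_monoid_add \<Rightarrow> 'x) \<Rightarrow> ('m::zero \<Rightarrow> 'x) \<Rightarrow> 'm poly \<Rightarrow> 'x" where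
  "subst_op T f p = (\<Sum>n\<le>degree p. (T ^^ n) (f (coeff p n)))"

text \<open>
  \<open>'m poly poly\<close> represents \<open>M[\<lambda>,\<mu>]\<close>, the inner variable being \<open>\<lambda>\<close> and the outer
  one \<open>\<mu>\<close>.
\<close>
definition mul_lam :: "'m::zero poly poly \<Rightarrow> 'm poly poly" where
  "mul_lam = map_poly (pCons 0)"

definition mul_mu :: "'m::zero poly poly \<Rightarrow> 'm poly poly" where
  "mul_mu = pCons 0"

definition in_lam :: "'m::ab_group_add poly \<Rightarrow> 'm poly poly" where
  "in_lam = subst_op mul_lam (\<lambda>x. [:[:x:]:])"

definition in_mu :: "'m::ab_group_add poly \<Rightarrow> 'm poly poly" where
  "in_mu = subst_op mul_mu (\<lambda>x. [:[:x:]:])"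

definition in_lam_plus_mu :: "'m::ab_group_add poly \<Rightarrow> 'm poly poly" where
  "in_lam_plus_mu = subst_op (\<lambda>p. mul_lam p + mul_mu p) (\<lambda>x. [:[:x:]:])"


section \<open>Gel'fand-Dorfman algebras\<close>

locale novikov_algebra = vector_space scale
  for scale :: "'k::field_char_0 \<Rightarrow> 'a::ab_group_add \<Rightarrow> 'a" +
  fixes nov :: "'a \<Rightarrow> 'a \<Rightarrow> 'a" (infixl "\<cdot>" 70)
  assumes nov_bilinear: "bilinear_map scale scale scale (\<cdot>)"
    and nov_left_symmetric: "(a \<cdot> b) \<cdot> c - a \<cdot> (b \<cdot> c) = (b \<cdot> a) \<cdot> c - b \<cdot> (a \<cdot> c)"
    and nov_right_commute: "(a \<cdot> b) \<cdot> c = (a \<cdot> c) \<cdot> b"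

locale lie_algebra = vector_space scale
  for scale :: "'k::field_char_0 \<Rightarrow> 'a::ab_group_add \<Rightarrow> 'a" +
  fixes lie :: "'a \<Rightarrow> 'a \<Rightarrow> 'a"
  assumes lie_bilinear: "bilinear_map scale scale scale lie"
    and lie_alternating: "lie a a = 0"
    and lie_jacobi: "lie a (lie b c) = lie (lie a b) c + lie b (lie a c)"

locale gelfand_dorfman_algebra = novikov_algebra scale nov + lie_algebra scale lie
  for scale :: "'k::field_char_0 \<Rightarrow> 'a::ab_group_add \<Rightarrow> 'a"
    and nov :: "'a \<Rightarrow> 'a \<Rightarrow> 'a" (infixl "\<cdot>" 70)
    and lie :: "'a \<Rightarrow> 'a \<Rightarrow> 'a" +
  assumes gd_compat:
    "lie (a \<cdot> b) c - lie (a \<cdot> c) b + lie a b \<cdot> c - lie a c \<cdot> b - a \<cdot> lie b c = 0"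

definition rota_baxter_identity ::
  "('k \<Rightarrow> 'a::ab_group_add \<Rightarrow> 'a) \<Rightarrow> 'k \<Rightarrow> ('a \<Rightarrow> 'a) \<Rightarrow> ('a \<Rightarrow> 'a \<Rightarrow> 'a) \<Rightarrow> bool" where
  "rota_baxter_identity scale \<theta> B m \<longleftrightarrow>
     (\<forall>a b. m (B a) (B b) = B (m (B a) b + m a (B b) + scale \<theta> (m a b)))"

locale rota_baxter_gda = gelfand_dorfman_algebra scale nov lie
  for scale :: "'k::field_char_0 \<Rightarrow> 'a::ab_group_add \<Rightarrow> 'a"
    and nov lie :: "'a \<Rightarrow> 'a \<Rightarrow> 'a" +
  fixes \<theta> :: 'k and B :: "'a \<Rightarrow> 'a"
  assumes rb_linear: "Vector_Spaces.linear scale scale B"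
    and rb_nov: "rota_baxter_identity scale \<theta> B nov"
    and rb_lie: "rota_baxter_identity scale \<theta> B lie"

locale quadratic_gda = gelfand_dorfman_algebra scale nov lie
  for scale :: "'k::field_char_0 \<Rightarrow> 'a::ab_group_add \<Rightarrow> 'a"
    and nov :: "'a \<Rightarrow> 'a \<Rightarrow> 'a" (infixl "\<cdot>" 70)
    and lie :: "'a \<Rightarrow> 'a \<Rightarrow> 'a" +
  fixes form :: "'a \<Rightarrow> 'a \<Rightarrow> 'k"
  assumes form_bilinear: "bilinear_map scale scale (*) form"
    and form_symmetric: "form a b = form b a"
    and form_nondegenerate: "(\<And>b. form a b = 0) \<Longrightarrow> a = 0"
    and form_lie: "form (lie a b) c = form a (lie b c)"
    and form_nov: "form (a \<cdot> b) c = - form b (a \<cdot> c + c \<cdot> a)"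

locale quadratic_rota_baxter_gda =
  rota_baxter_gda scale nov lie \<theta> B + quadratic_gda scale nov lie form
  for scale :: "'k::field_char_0 \<Rightarrow> 'a::ab_group_add \<Rightarrow> 'a"
    and nov lie :: "'a \<Rightarrow> 'a \<Rightarrow> 'a"
    and \<theta> :: 'k and B :: "'a \<Rightarrow> 'a" and form :: "'a \<Rightarrow> 'a \<Rightarrow> 'k" +
  assumes form_rb: "form (B a) b + form a (B b) + \<theta> * form a b = 0"


section \<open>Lie conformal algebras\<close>

text \<open>
  A \<open>k[\<partial>]\<close>-module is a module over the ring \<open>'k poly\<close>; \<open>act [:c:]\<close> is the action of a
  scalar and \<open>act [:0, 1:]\<close> that of \<open>\<partial>\<close>.
\<close>
abbreviation scalar_act :: "('k::zero poly \<Rightarrow> 'm \<Rightarrow> 'm) \<Rightarrow> 'k \<Rightarrow> 'm \<Rightarrow> 'm" where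
  "scalar_act act c \<equiv> act [:c:]"

abbreviation D_act :: "('k::zero_neq_one poly \<Rightarrow> 'm \<Rightarrow> 'm) \<Rightarrow> 'm \<Rightarrow> 'm" where
  "D_act act \<equiv> act [:0, 1:]"

text \<open>
  In the Jacobi identity each of the three terms is a polynomial in one variable whose
  coefficients are bracketed with a further element: e.g. if \<open>[a\<^sub>\<lambda> b] = \<Sum>\<^sub>n \<lambda>\<^sup>n x\<^sub>n\<close> then
  \<open>[[a\<^sub>\<lambda> b]\<^bsub>\<lambda>+\<mu>\<^esub> c] = \<Sum>\<^sub>n \<lambda>\<^sup>n [x\<^sub>n \<^bsub>\<lambda>+\<mu>\<^esub> c]\<close>.
\<close>
locale lie_conformal_algebra = module act
  for act :: "'k::field_char_0 poly \<Rightarrow> 'm::ab_group_add \<Rightarrow> 'm" +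
  fixes br :: "'m \<Rightarrow> 'm \<Rightarrow> 'm poly"
  assumes br_bilinear:
      "bilinear_map (scalar_act act) (scalar_act act) (\<lambda>c. map_poly (scalar_act act c)) br"
    and br_D_left: "br (D_act act a) b = - pCons 0 (br a b)"
    and br_D_right: "br a (D_act act b) = pCons 0 (br a b) + map_poly (D_act act) (br a b)"
    and br_skew:
      "br a b = - subst_op (\<lambda>p. - pCons 0 p - map_poly (D_act act) p) (\<lambda>x. [:x:]) (br b a)"
    and br_jacobi:
      "subst_op mul_mu (\<lambda>x. in_lam (br a x)) (br b c) =
       subst_op mul_lam (\<lambda>x. in_lam_plus_mu (br x c)) (br a b) +
       subst_op mul_lam (\<lambda>x. in_mu (br b x)) (br a c)"

locale rota_baxter_lie_conformal_algebra = lie_conformal_algebra act br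
  for act :: "'k::field_char_0 poly \<Rightarrow> 'm::ab_group_add \<Rightarrow> 'm"
    and br :: "'m \<Rightarrow> 'm \<Rightarrow> 'm poly" +
  fixes \<theta> :: 'k and B :: "'m \<Rightarrow> 'm"
  assumes rb_hom: "module_hom act act B"
    and rb_br:
      "br (B a) (B b) =
       map_poly B (br (B a) b + br a (B b) + map_poly (scalar_act act \<theta>) (br a b))"

definition conformal_bilinear_form ::
  "('k::field_char_0 poly \<Rightarrow> 'm::ab_group_add \<Rightarrow> 'm) \<Rightarrow> ('m \<Rightarrow> 'm \<Rightarrow> 'k poly) \<Rightarrow> bool" where
  "conformal_bilinear_form act \<omega> \<longleftrightarrow>
     bilinear_map (scalar_act act) (scalar_act act) smult \<omega> \<and>
     (\<forall>a b. \<omega> (D_act act a) b = - [:0, 1:] * \<omega> a b) \<and>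
     (\<forall>a b. \<omega> a (D_act act b) = [:0, 1:] * \<omega> a b)"

definition conformal_dual ::
  "('k::field_char_0 poly \<Rightarrow> 'm::ab_group_add \<Rightarrow> 'm) \<Rightarrow> ('m \<Rightarrow> 'k poly) set" where
  "conformal_dual act =
     {f. Vector_Spaces.linear (scalar_act act) smult f \<and>
         (\<forall>a. f (D_act act a) = [:0, 1:] * f a)}"

text \<open>Since \<open>(\<partial> f)\<^sub>\<lambda> = - \<lambda> f\<^sub>\<lambda>\<close>, the element \<open>q(\<partial>)\<close> acts as multiplication by \<open>q(- \<lambda>)\<close>.\<close>
definition conformal_dual_act ::
  "'k::field_char_0 poly \<Rightarrow> ('m \<Rightarrow> 'k poly) \<Rightarrow> 'm \<Rightarrow> 'k poly" where
  "conformal_dual_act q f = (\<lambda>a. pcompose q [:0, -1:] * f a)"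

definition conformal_nondegenerate ::
  "('k::field_char_0 poly \<Rightarrow> 'm::ab_group_add \<Rightarrow> 'm) \<Rightarrow> ('m \<Rightarrow> 'm \<Rightarrow> 'k poly) \<Rightarrow> bool" where
  "conformal_nondegenerate act \<omega> \<longleftrightarrow>
     bij_betw \<omega> UNIV (conformal_dual act) \<and>
     (\<forall>a b. \<omega> (a + b) = (\<lambda>c. \<omega> a c + \<omega> b c)) \<and>
     (\<forall>q a. \<omega> (act q a) = conformal_dual_act q (\<omega> a))"

definition conformal_symmetric :: "('m \<Rightarrow> 'm \<Rightarrow> 'k::field_char_0 poly) \<Rightarrow> bool" where
  "conformal_symmetric \<omega> \<longleftrightarrow> (\<forall>a b. \<omega> a b = pcompose (\<omega> b a) [:0, -1:])"

text \<open>\<open>\<omega>\<^sub>\<lambda>([a\<^sub>\<mu> b], c) = \<omega>\<^sub>\<mu>(a, [b\<^bsub>\<lambda>-\<mu>\<^esub> c])\<close>, as an identity in \<open>k[\<lambda>,\<mu>]\<close>.\<close>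
definition conformal_invariant ::
  "('m::zero \<Rightarrow> 'm \<Rightarrow> 'm poly) \<Rightarrow> ('m \<Rightarrow> 'm \<Rightarrow> 'k::field_char_0 poly) \<Rightarrow> bool" where
  "conformal_invariant br \<omega> \<longleftrightarrow>
     (\<forall>a b c. subst_op mul_mu (\<lambda>x. in_lam (\<omega> x c)) (br a b) =
              subst_op (\<lambda>p. mul_lam p - mul_mu p) (\<lambda>x. in_mu (\<omega> a x)) (br b c))"

locale quadratic_rota_baxter_lie_conformal_algebra =
  rota_baxter_lie_conformal_algebra act br \<theta> B
  for act :: "'k::field_char_0 poly \<Rightarrow> 'm::ab_group_add \<Rightarrow> 'm"
    and br :: "'m \<Rightarrow> 'm \<Rightarrow> 'm poly"
    and \<theta> :: 'k and B :: "'m \<Rightarrow> 'm" +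
  fixes \<omega> :: "'m \<Rightarrow> 'm \<Rightarrow> 'k poly"
  assumes \<omega>_form: "conformal_bilinear_form act \<omega>"
    and \<omega>_nondegenerate: "conformal_nondegenerate act \<omega>"
    and \<omega>_symmetric: "conformal_symmetric \<omega>"
    and \<omega>_invariant: "conformal_invariant br \<omega>"
    and \<omega>_rb: "\<omega> a (B b) + \<omega> (B a) b + smult \<theta> (\<omega> a b) = 0"


section \<open>The Lie conformal algebra of a Gel'fand-Dorfman algebra\<close>

text \<open>
  \<open>R(A) = k[\<partial>] \<otimes> A\<close> is \<open>'a poly\<close>, \<open>\<partial>\<^sup>n \<otimes> a\<close> being \<open>monom a n\<close>; in particular
  \<open>A\<close> is embedded as the constant polynomials.
\<close>
definition R_act :: "('k::zero \<Rightarrow> 'a::ab_group_add \<Rightarrow> 'a) \<Rightarrow> 'k poly \<Rightarrow> 'a poly \<Rightarrow> 'a poly" where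
  "R_act scale q x = subst_op (pCons 0) (\<lambda>c. map_poly (scale c) x) q"

definition R_embed :: "'a::zero \<Rightarrow> 'a poly" where
  "R_embed a = [:a:]"

text \<open>\<open>[a\<^sub>\<lambda> b]\<close> for \<open>a, b\<close> in \<open>A\<close>; the inner variable is \<open>\<partial>\<close>, the outer one \<open>\<lambda>\<close>.\<close>
definition R_bracket_gen ::
  "('a::ab_group_add \<Rightarrow> 'a \<Rightarrow> 'a) \<Rightarrow> ('a \<Rightarrow> 'a \<Rightarrow> 'a) \<Rightarrow> 'a \<Rightarrow> 'a \<Rightarrow> 'a poly poly" where
  "R_bracket_gen nov lie a b = [: [: lie a b, nov b a :], [: nov a b + nov b a :] :]"

text \<open>\<open>[f(\<partial>) a \<^sub>\<lambda> g(\<partial>) b] = f(- \<lambda>) g(\<lambda> + \<partial>) [a\<^sub>\<lambda> b]\<close>, extended additively.\<close>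
definition R_bracket ::
  "('a::ab_group_add \<Rightarrow> 'a \<Rightarrow> 'a) \<Rightarrow> ('a \<Rightarrow> 'a \<Rightarrow> 'a) \<Rightarrow> 'a poly \<Rightarrow> 'a poly \<Rightarrow> 'a poly poly" where
  "R_bracket nov lie x y =
     subst_op (\<lambda>p. - pCons 0 p)
       (\<lambda>a. subst_op (\<lambda>p. pCons 0 p + map_poly (pCons 0) p) (R_bracket_gen nov lie a) y) x"

text \<open>\<open>\<omega>\<^sub>\<lambda>(f(\<partial>) a, g(\<partial>) b) = f(- \<lambda>) g(\<lambda>) (a, b)\<close>, extended additively.\<close>
definition R_form ::
  "('a::zero \<Rightarrow> 'a \<Rightarrow> 'k::field_char_0) \<Rightarrow> 'a poly \<Rightarrow> 'a poly \<Rightarrow> 'k poly" where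
  "R_form form x y =
     subst_op (\<lambda>p. - pCons 0 p) (\<lambda>a. subst_op (pCons 0) (\<lambda>b. [:form a b:]) y) x"

text \<open>For \<open>B\<close> mapping \<open>A\<close> into \<open>A\<close>, this is the map \<open>b\<close> on \<open>A\<close> with \<open>B [:a:] = [:b a:]\<close>.\<close>
definition R_restrict :: "('a::zero poly \<Rightarrow> 'a poly) \<Rightarrow> 'a \<Rightarrow> 'a" where
  "R_restrict B a = coeff (B (R_embed a)) 0"

end

theory Submission
  imports Defs
begin

text \<open>
  Every axiom in the theorem is an identity between maps on \<open>R(A) = k[\<partial>] \<otimes> A\<close> that are additive
  in each argument and for which replacing an argument \<open>x\<close> by \<open>\<partial> x\<close> has the same effect on both
  sides, namely the application of one fixed operator in \<open>\<partial>\<close>, \<open>\<lambda>\<close>, \<open>\<mu>\<close>. For instance both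
  sides of the Jacobi identity are multiplied by \<open>- \<lambda>\<close>, \<open>- \<mu>\<close> and \<open>\<lambda> + \<mu> + \<partial>\<close> when \<open>\<partial>\<close> is
  applied to the first, second and third argument. Since \<open>A\<close> generates \<open>R(A)\<close> over \<open>k[\<partial>]\<close>, such
  an identity holds on \<open>R(A)\<close> as soon as it holds on \<open>A\<close> (\<open>poly_ext\<close> for one argument,
  \<open>sesquilinear_ext\<close> for two). On \<open>A\<close> both sides are explicit polynomials of small degree, and
  comparing coefficients turns the identity into finitely many identities in \<open>A\<close>.

  For the bracket this gives that \<open>R(A)\<close> is a Lie conformal algebra: skew-symmetry amounts to
  skew-symmetry of the Lie bracket, and the coefficients of the Jacobi identity are consequences
  of the Lie, Novikov and compatibility axioms (\<open>R_bracket_jacobi_const\<close>). The map \<open>B\<close> is its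
  restriction \<open>b\<close> to \<open>A\<close> applied to all coefficients (\<open>R_restrict_eq\<close>), and the coefficients of the
  Rota-Baxter identity on \<open>A\<close> are exactly the identities of \<open>b\<close> for the two products: the one at
  \<open>\<partial>\<close> is that of the Novikov product, the constant one that of the Lie bracket, and the one at
  \<open>\<lambda>\<close> follows (\<open>rota_baxter_bracket_iff\<close>).

  For the form, symmetry, invariance and compatibility with \<open>B\<close> are treated in the same way.
  Non-degeneracy is different, as it asserts surjectivity onto the conformal dual. An element \<open>f\<close> of
  the conformal dual is determined by its values \<open>f(b) = \<Sum>\<^sub>n \<lambda>\<^sup>n f\<^sub>n(b)\<close> on \<open>A\<close>. As \<open>A\<close> is
  finite-dimensional, only finitely many functionals \<open>f\<^sub>n\<close> are non-zero, and each is \<open>(r\<^sub>n, \<cdot>)\<close> for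
  some \<open>r\<^sub>n\<close> in \<open>A\<close>; then \<open>f\<close> is the image of \<open>\<Sum>\<^sub>n (- \<partial>)\<^sup>n r\<^sub>n\<close>
  (\<open>conformal_nondegenerate_R_form_iff\<close>).
\<close>

section \<open>Substituting an operator into a polynomial\<close>

text \<open>
  Constants generate the polynomials over a module under addition and multiplication by the
  variable. In \<open>R(A)\<close> this says that \<open>A\<close> generates it as a \<open>k[\<partial>]\<close>-module.
\<close>
lemma poly_gen_induct [case_names const add shift]:
  fixes p :: "'a::ab_group_add poly"
  assumes "\<And>a. P [:a:]" and "\<And>p q. P p \<Longrightarrow> P q \<Longrightarrow> P (p + q)" and "\<And>p. P p \<Longrightarrow> P (pCons 0 p)"
  shows "P p"
proof (induction p)
  case 0
  show ?case using assms(1)[of 0] by simp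
next
  case (pCons a p)
  have "P ([:a:] + pCons 0 p)" using assms pCons by blast
  then show ?case by simp
qed

lemma additive_pCons_0: "additive (pCons (0::'a::ab_group_add))"
  by (simp add: additive_def)

lemma additive_const_poly: "additive (\<lambda>x::'a::ab_group_add. [:x:])"
  by (simp add: additive_def)

lemma additive_map_poly:
  fixes f :: "'a::ab_group_add \<Rightarrow> 'b::ab_group_add"
  assumes "additive f"
  shows "additive (map_poly f)"
  using assms additive.zero[OF assms] by (auto simp: additive_def poly_eq_iff coeff_map_poly)

lemma additive_comp: "additive f \<Longrightarrow> additive g \<Longrightarrow> additive (\<lambda>x. f (g x))"
  by (simp add: additive_def)

lemma additive_plus: "additive f \<Longrightarrow> additive g \<Longrightarrow> additive (\<lambda>x. f x + g x)"
  by (simp add: additive_def algebra_simps)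

lemma additive_uminus: "additive f \<Longrightarrow> additive (\<lambda>x. - f x)"
  by (simp add: additive_def)

lemma additive_minus: "additive f \<Longrightarrow> additive g \<Longrightarrow> additive (\<lambda>x. f x - g x)"
  by (simp add: additive_def algebra_simps)

lemma additive_mul_lam: "additive (mul_lam :: 'm::ab_group_add poly poly \<Rightarrow> _)"
  unfolding mul_lam_def by (intro additive_map_poly additive_pCons_0)

lemma additive_mul_mu: "additive (mul_mu :: 'm::ab_group_add poly poly \<Rightarrow> _)"
  unfolding mul_mu_def by (rule additive_pCons_0)

lemmas additive_intros = additive_pCons_0 additive_const_poly additive_map_poly additive_mul_lam
  additive_mul_mu additive_plus additive_uminus additive_minus

lemma additive_funpow:
  fixes T :: "'x::ab_group_add \<Rightarrow> 'x"
  shows "additive T \<Longrightarrow> additive (T ^^ n)"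
  by (induction n) (simp_all add: additive_def)

text \<open>
  The degree bound in the sum may be raised freely; this makes sums for different polynomials
  comparable.
\<close>
lemma subst_op_eq_sum:
  assumes "additive T" and "f 0 = 0" and "degree p \<le> N"
  shows "subst_op T f p = (\<Sum>n\<le>N. (T ^^ n) (f (coeff p n)))"
proof -
  have z: "(T ^^ n) 0 = 0" for n
    using additive.zero[OF additive_funpow[OF assms(1)]] .
  show ?thesis
    unfolding subst_op_def
    using assms(2,3) by (intro sum.mono_neutral_left) (auto simp: coeff_eq_0 z)
qed

text \<open>
  The Horner recursion. Together with additivity it is what all later arguments use in place of the
  defining sum.
\<close>
lemma subst_op_pCons:
  assumes "additive T" and "f 0 = 0"
  shows "subst_op T f (pCons a p) = f a + T (subst_op T f p)"
proof -
  have "subst_op T f (pCons a p) = (\<Sum>n\<le>Suc (degree p). (T ^^ n) (f (coeff (pCons a p) n)))"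
    using assms by (intro subst_op_eq_sum) (auto simp: degree_pCons_le)
  also have "\<dots> = f a + T (\<Sum>n\<le>degree p. (T ^^ n) (f (coeff p n)))"
    by (simp add: sum.atMost_Suc_shift additive.sum[OF assms(1)] del: sum.atMost_Suc)
  finally show ?thesis by (simp add: subst_op_def)
qed

lemma subst_op_0 [simp]: "f 0 = 0 \<Longrightarrow> subst_op T f 0 = 0"
  by (simp add: subst_op_def)

lemma additive_subst_op:
  fixes f :: "'m::ab_group_add \<Rightarrow> 'x::ab_group_add"
  assumes "additive T" and "additive f"
  shows "additive (subst_op T f)"
proof
  fix p q :: "'m poly"
  have f0: "f 0 = 0" by (rule additive.zero[OF assms(2)])
  let ?N = "max (degree p) (degree q)"
  have "degree (p + q) \<le> ?N" by (rule degree_add_le_max)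
  then show "subst_op T f (p + q) = subst_op T f p + subst_op T f q"
    using assms(1) f0
    by (simp add: subst_op_eq_sum[where N = ?N] additive.add[OF assms(2)]
        additive.add[OF additive_funpow[OF assms(1)]] sum.distrib)
qed

lemma subst_op_const: "additive T \<Longrightarrow> f 0 = 0 \<Longrightarrow> subst_op T f [:a:] = f a"
  by (simp add: subst_op_pCons additive.zero)

lemma subst_op_shift: "additive T \<Longrightarrow> f 0 = 0 \<Longrightarrow> subst_op T f (pCons 0 p) = T (subst_op T f p)"
  by (simp add: subst_op_pCons)

lemma subst_op_map_poly:
  assumes "additive T" and "f 0 = 0" and "g 0 = 0"
  shows "subst_op T f (map_poly g p) = subst_op T (\<lambda>x. f (g x)) p"
  by (induction p) (use assms in \<open>simp_all add: subst_op_pCons map_poly_pCons\<close>)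

lemma subst_op_fun_add:
  assumes "additive T"
  shows "subst_op T (\<lambda>x. f x + g x) p = subst_op T f p + subst_op T g p"
  by (simp add: subst_op_def additive.add[OF additive_funpow[OF assms]] sum.distrib)

lemma subst_op_fun_diff:
  assumes "additive T"
  shows "subst_op T (\<lambda>x. f x - g x) p = subst_op T f p - subst_op T g p"
  by (simp add: subst_op_def additive.diff[OF additive_funpow[OF assms]] sum_subtractf)

text \<open>
  An operator on the coefficients that commutes with the substituted one can be pulled out of the
  substitution. This yields all the rules for moving \<open>\<partial>\<close>, \<open>\<lambda>\<close>, \<open>\<mu>\<close> out of iterated
  brackets.
\<close>
lemma subst_op_commute:
  assumes "additive S" and "\<And>p. S (T p) = T (S p)"
  shows "subst_op T (\<lambda>x. S (f x)) p = S (subst_op T f p)"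
proof -
  have "S ((T ^^ n) y) = (T ^^ n) (S y)" for n y
    by (induction n) (simp_all add: assms)
  then show ?thesis
    by (simp add: subst_op_def additive.sum[OF assms(1)])
qed

lemma subst_op_fun_uminus:
  assumes "additive T"
  shows "subst_op T (\<lambda>x. - f x) p = - subst_op T f p"
  by (rule subst_op_commute) (simp_all add: additive_def additive.minus[OF assms])

text \<open>
  Renaming the variable to \<open>\<lambda>\<close> or \<open>\<mu>\<close> is an inclusion of \<open>M[\<lambda>]\<close> into \<open>M[\<lambda>,\<mu>]\<close>:
  the polynomial becomes a constant in the outer variable, or its coefficients become constants in
  the inner one.
\<close>
lemma in_lam_eq: "in_lam p = [:p:]"
  unfolding in_lam_def
  by (induction p) (simp_all add: subst_op_pCons additive_mul_lam, simp add: mul_lam_def map_poly_pCons)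

lemma in_mu_eq: "in_mu p = map_poly (\<lambda>x. [:x:]) p"
  unfolding in_mu_def
  by (induction p) (simp_all add: subst_op_pCons additive_mul_mu map_poly_pCons, simp add: mul_mu_def)


section \<open>Sesquilinear extension\<close>

text \<open>
  An additive map on which the variable acts by a fixed operator is determined by its values on
  constants.
\<close>
lemma poly_ext:
  fixes F G :: "'a::ab_group_add poly \<Rightarrow> 'x::ab_group_add"
  assumes "additive F" and "additive G"
    and "\<And>x. F (pCons 0 x) = S (F x)" and "\<And>x. G (pCons 0 x) = S (G x)"
    and "\<And>a. F [:a:] = G [:a:]"
  shows "F x = G x"
  by (induction x rule: poly_gen_induct) (simp_all add: assms additive.add[OF assms(1)] additive.add[OF assms(2)])

text \<open>
  Both \<open>[\<cdot>\<^sub>\<lambda> \<cdot>]\<close>, with \<open>S = - \<lambda>\<close> and \<open>T = \<lambda> + \<partial>\<close>, and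
  \<open>\<omega>\<^sub>\<lambda>\<close>, with \<open>S = - \<lambda>\<close> and \<open>T = \<lambda>\<close>, have this shape, and so have all
  expressions obtained from them by applying maps that commute with these operators.
\<close>
definition sesquilinear ::
  "('x::ab_group_add \<Rightarrow> 'x) \<Rightarrow> ('x \<Rightarrow> 'x) \<Rightarrow>
   ('a::ab_group_add poly \<Rightarrow> 'b::ab_group_add poly \<Rightarrow> 'x) \<Rightarrow> bool" where
  "sesquilinear S T F \<longleftrightarrow>
     (\<forall>y. additive (\<lambda>x. F x y)) \<and> (\<forall>x. additive (F x)) \<and>
     (\<forall>x y. F (pCons 0 x) y = S (F x y)) \<and> (\<forall>x y. F x (pCons 0 y) = T (F x y))"

lemma sesquilinear_ext:
  assumes F: "sesquilinear S T F" and G: "sesquilinear S T G"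
    and "\<And>a b. F [:a:] [:b:] = G [:a:] [:b:]"
  shows "F x y = G x y"
proof (rule poly_ext[where F = "\<lambda>x. F x y" and G = "\<lambda>x. G x y" and S = S])
  show "F [:a:] y = G [:a:] y" for a
    by (rule poly_ext[where S = T]) (use assms in \<open>auto simp: sesquilinear_def\<close>)
qed (use F G in \<open>auto simp: sesquilinear_def\<close>)

text \<open>
  The common pattern of the bracket and of the form on \<open>R(A)\<close>.
\<close>
definition sesquilinear_extension ::
  "('x::ab_group_add \<Rightarrow> 'x) \<Rightarrow> ('x \<Rightarrow> 'x) \<Rightarrow> ('a::ab_group_add \<Rightarrow> 'b::ab_group_add \<Rightarrow> 'x) \<Rightarrow>
   'a poly \<Rightarrow> 'b poly \<Rightarrow> 'x" where
  "sesquilinear_extension S T g x y = subst_op S (\<lambda>a. subst_op T (g a) y) x"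

context
  fixes S T :: "'x::ab_group_add \<Rightarrow> 'x" and g :: "'a::ab_group_add \<Rightarrow> 'b::ab_group_add \<Rightarrow> 'x"
  assumes S: "additive S" and T: "additive T" and ST: "\<And>p. S (T p) = T (S p)"
    and g_left: "\<And>b. additive (\<lambda>a. g a b)" and g_right: "\<And>a. additive (g a)"
begin

lemma additive_inner: "additive (\<lambda>a. subst_op T (g a) y)"
proof
  fix a b
  have "g (a + b) = (\<lambda>c. g a c + g b c)"
    using additive.add[OF g_left] by auto
  then show "subst_op T (g (a + b)) y = subst_op T (g a) y + subst_op T (g b) y"
    by (simp add: subst_op_fun_add[OF T])
qed

lemma sesquilinear_extension_const:
  "sesquilinear_extension S T g [:a:] [:b:] = g a b"
  unfolding sesquilinear_extension_def
  using additive.zero[OF additive_inner] additive.zero[OF g_right]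
  by (subst subst_op_const[OF S]) (simp_all add: subst_op_const T)

text \<open>
  The rule for the left argument is the Horner recursion of the outer substitution. In the right
  argument the operator \<open>T\<close> appears inside the outer substitution and is pulled out because it
  commutes with \<open>S\<close>.
\<close>
lemma sesquilinear_sesquilinear_extension:
  "sesquilinear S T (sesquilinear_extension S T g)"
proof -
  have "sesquilinear_extension S T g x (y + z) =
    sesquilinear_extension S T g x y + sesquilinear_extension S T g x z" for x y z
    unfolding sesquilinear_extension_def
    by (simp add: additive.add[OF additive_subst_op[OF T g_right]] subst_op_fun_add[OF S])
  moreover have "additive (\<lambda>x. sesquilinear_extension S T g x y)" for y
    unfolding sesquilinear_extension_def
    by (intro additive_subst_op additive_inner S)
  moreover have "sesquilinear_extension S T g (pCons 0 x) y = S (sesquilinear_extension S T g x y)" for x y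
    unfolding sesquilinear_extension_def
    by (intro subst_op_shift S additive.zero[OF additive_inner])
  moreover have "sesquilinear_extension S T g x (pCons 0 y) = T (sesquilinear_extension S T g x y)" for x y
    unfolding sesquilinear_extension_def
    by (simp add: subst_op_shift T additive.zero[OF g_right] subst_op_commute[where S = T and T = S, OF T ST[symmetric]])
  ultimately show ?thesis
    by (simp add: sesquilinear_def additive_def)
qed

end

section \<open>Bilinear maps\<close>

lemma bilinear_mapD:
  assumes "bilinear_map s1 s2 s3 f"
  shows "additive (f x)" "additive (\<lambda>x. f x y)" "f (s1 c x) y = s3 c (f x y)" "f x (s2 c y) = s3 c (f x y)"
    "vector_space s1" "vector_space s2" "vector_space s3"
  using assms by (auto simp: bilinear_map_def Vector_Spaces.linear_iff additive_def)

lemma bilinear_mapI: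
  assumes "vector_space s1" "vector_space s2" "vector_space s3"
    "\<And>x. additive (f x)" "\<And>y. additive (\<lambda>x. f x y)"
    "\<And>c x y. f (s1 c x) y = s3 c (f x y)" "\<And>c x y. f x (s2 c y) = s3 c (f x y)"
  shows "bilinear_map s1 s2 s3 f"
  using assms by (auto simp: bilinear_map_def Vector_Spaces.linear_iff additive_def)

lemma vector_space_map_poly:
  assumes "vector_space s"
  shows "vector_space (\<lambda>c. map_poly (s c))"
proof -
  interpret vector_space s by fact
  show ?thesis
    by unfold_locales (auto simp: poly_eq_iff coeff_map_poly algebra_simps)
qed

lemma vector_space_smult: "vector_space (smult :: 'k::field \<Rightarrow> _)"
  by unfold_locales (simp_all add: smult_add_right smult_add_left)

section \<open>The \<open>k[\<partial>]\<close>-module \<open>R(A)\<close>\<close>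

lemma R_act_const:
  assumes "vector_space scale"
  shows "R_act scale [:c:] x = map_poly (scale c) x"
proof -
  interpret vector_space scale by fact
  have "map_poly (scale 0) x = 0" by (auto simp: poly_eq_iff coeff_map_poly)
  then show ?thesis
    unfolding R_act_def by (intro subst_op_const additive_pCons_0)
qed

lemma R_act_pCons:
  assumes "vector_space scale"
  shows "R_act scale (pCons c q) x = map_poly (scale c) x + pCons 0 (R_act scale q x)"
proof -
  interpret vector_space scale by fact
  have "map_poly (scale 0) x = 0" by (auto simp: poly_eq_iff coeff_map_poly)
  then show ?thesis
    unfolding R_act_def by (intro subst_op_pCons additive_pCons_0)
qed

lemma R_act_D:
  assumes "vector_space scale"
  shows "R_act scale [:0, 1:] x = pCons 0 x"
proof -
  interpret vector_space scale by fact
  have "map_poly (scale 0) x = 0" "map_poly (scale 1) x = x" by (auto simp: poly_eq_iff coeff_map_poly)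
  then show ?thesis
    by (simp only: R_act_pCons[OF assms, of 0 "[:1:]"] R_act_const[OF assms, of 1]) simp
qed

lemma R_act_eqs:
  assumes "vector_space scale"
  shows "D_act (R_act scale) = pCons 0" and "scalar_act (R_act scale) c = map_poly (scale c)"
  using R_act_D[OF assms] R_act_const[OF assms] by blast+

text \<open>
  Commuting with \<open>\<partial>\<close> and preserving \<open>A\<close> forces \<open>B (\<partial>\<^sup>n a) = \<partial>\<^sup>n (B a)\<close>, which is the
  coefficientwise extension of the restriction to \<open>A\<close>.
\<close>
lemma R_restrict_eq:
  assumes vs: "vector_space scale"
    and hom: "module_hom (R_act scale) (R_act scale) B"
    and const: "B ` range R_embed \<subseteq> range R_embed"
  shows "B = map_poly (R_restrict B)" and "Vector_Spaces.linear scale scale (R_restrict B)"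
proof -
  interpret vs: vector_space scale by fact
  interpret module_hom "R_act scale" "R_act scale" B by fact
  have B_const: "B [:a:] = [:R_restrict B a:]" for a
  proof -
    have "B [:a:] \<in> range (\<lambda>a. [:a:])"
      using const unfolding R_embed_def by blast
    then show ?thesis
      by (auto simp: R_restrict_def R_embed_def)
  qed
  have B_add: "additive B" by (simp add: additive_def add)
  have B_shift: "B (pCons 0 x) = pCons 0 (B x)" for x
    using scale[of "[:0, 1:]" x] by (simp add: R_act_D[OF vs])
  have B_scale: "B (map_poly (scale c) x) = map_poly (scale c) (B x)" for c x
    using scale[of "[:c:]" x] by (simp add: R_act_const[OF vs])
  have "R_restrict B (a + b) = R_restrict B a + R_restrict B b" for a b
    using additive.add[OF B_add, of "[:a:]" "[:b:]"] by (simp add: B_const)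
  moreover have "R_restrict B (scale c a) = scale c (R_restrict B a)" for c a
    using B_scale[of c "[:a:]"] by (simp add: B_const map_poly_pCons)
  ultimately show linear: "Vector_Spaces.linear scale scale (R_restrict B)"
    using vs by (simp add: Vector_Spaces.linear_iff)
  then have restrict_add: "additive (R_restrict B)"
    by (simp add: Vector_Spaces.linear_iff additive_def)
  show "B = map_poly (R_restrict B)"
  proof
    show "B x = map_poly (R_restrict B) x" for x
      by (rule poly_ext[where F = B and S = "pCons 0"])
        (simp_all add: B_add B_shift B_const additive_map_poly restrict_add map_poly_pCons
          additive.zero[OF restrict_add])
  qed
qed

section \<open>Commuting operators on polynomials in \<open>\<partial>\<close>, \<open>\<lambda>\<close> and \<open>\<mu>\<close>\<close>

abbreviation lam_plus_D :: "'a::ab_group_add poly poly \<Rightarrow> 'a poly poly" where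
  "lam_plus_D p \<equiv> pCons 0 p + map_poly (pCons 0) p"

lemma map_poly_pCons_commute:
  assumes "f 0 = 0"
  shows "map_poly (map_poly f) (map_poly (pCons 0) p) = map_poly (pCons 0) (map_poly (map_poly f) p)"
  using assms by (simp add: poly_eq_iff coeff_map_poly coeff_pCons split: nat.splits)

lemma additive_lam_plus_D: "additive (lam_plus_D :: 'a::ab_group_add poly poly \<Rightarrow> _)"
  by (intro additive_intros)

lemma additive_minus_pCons: "additive (\<lambda>p::'a::ab_group_add poly. - pCons 0 p)"
  by (intro additive_intros)

lemma minus_pCons_commute: "- pCons 0 (lam_plus_D p) = lam_plus_D (- pCons 0 (p::'a::ab_group_add poly poly))"
  by (simp add: map_poly_pCons additive.minus[OF additive_map_poly[OF additive_pCons_0]])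

text \<open>
  The action of \<open>\<partial>\<close> on \<open>R(A)[\<lambda>,\<mu>]\<close>, where \<open>\<partial>\<close> is the innermost variable.
\<close>
abbreviation mul_D :: "'a::ab_group_add poly poly poly \<Rightarrow> 'a poly poly poly" where
  "mul_D \<equiv> map_poly (map_poly (pCons 0))"

lemma in_additive:
  "additive (in_lam :: 'm::ab_group_add poly \<Rightarrow> _)" "additive (in_mu :: 'm poly \<Rightarrow> _)"
  "additive (in_lam_plus_mu :: 'm poly \<Rightarrow> _)"
  unfolding in_lam_def in_mu_def in_lam_plus_mu_def
  by (intro additive_subst_op additive_intros; simp add: additive_def)+

lemma in_shift:
  "in_lam (pCons 0 p) = mul_lam (in_lam (p :: 'm::ab_group_add poly))"
  "in_mu (pCons 0 p) = mul_mu (in_mu p)"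
  "in_lam_plus_mu (pCons 0 p) = mul_lam (in_lam_plus_mu p) + mul_mu (in_lam_plus_mu p)"
  unfolding in_lam_def in_mu_def in_lam_plus_mu_def
  by (intro subst_op_shift additive_intros; simp)+

lemma in_lam_plus_mu_pCons:
  "in_lam_plus_mu (pCons x p) =
     [:[:x:]:] + mul_lam (in_lam_plus_mu p) + mul_mu (in_lam_plus_mu (p :: 'm::ab_group_add poly))"
  unfolding in_lam_plus_mu_def by (subst subst_op_pCons) (simp_all add: additive_intros)

lemma mul_commute: "mul_lam (mul_mu p) = mul_mu (mul_lam (p :: 'm::ab_group_add poly poly))"
  by (simp add: mul_lam_def mul_mu_def map_poly_pCons)

lemma mul_D_commute: "mul_D (mul_lam p) = mul_lam (mul_D p)" "mul_D (mul_mu p) = mul_mu (mul_D p)"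
  by (simp_all add: mul_lam_def mul_mu_def map_poly_pCons map_poly_pCons_commute)

lemma additive_mul_D: "additive mul_D"
  by (intro additive_intros)

lemma in_mul_D:
  "in_lam (map_poly (pCons 0) p) = mul_D (in_lam p)"
  "in_mu (map_poly (pCons 0) p) = mul_D (in_mu p)"
  "in_lam_plus_mu (map_poly (pCons 0) p) = mul_D (in_lam_plus_mu p)"
proof -
  have *: "subst_op T (\<lambda>x. [:[:x:]:]) (map_poly (pCons 0) p) = mul_D (subst_op T (\<lambda>x. [:[:x:]:]) p)"
    if "additive T" "\<And>p. mul_D (T p) = T (mul_D p)" for T
  proof -
    have "subst_op T (\<lambda>x. [:[:x:]:]) (map_poly (pCons 0) p) = subst_op T (\<lambda>x. mul_D [:[:x:]:]) p"
      by (simp add: subst_op_map_poly that map_poly_pCons)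
    also have "\<dots> = mul_D (subst_op T (\<lambda>x. [:[:x:]:]) p)"
      by (rule subst_op_commute[where S = mul_D and T = T, OF additive_mul_D that(2)])
    finally show ?thesis .
  qed
  show "in_lam (map_poly (pCons 0) p) = mul_D (in_lam p)"
    unfolding in_lam_def by (intro * additive_intros mul_D_commute)
  show "in_mu (map_poly (pCons 0) p) = mul_D (in_mu p)"
    unfolding in_mu_def by (intro * additive_intros mul_D_commute)
  show "in_lam_plus_mu (map_poly (pCons 0) p) = mul_D (in_lam_plus_mu p)"
    unfolding in_lam_plus_mu_def
    by (intro * additive_intros) (simp_all add: mul_D_commute additive.add[OF additive_mul_D])
qed

lemma subst_op_mul:
  fixes f :: "'m::zero \<Rightarrow> 'n::ab_group_add poly poly"
  shows "subst_op mul_mu (\<lambda>x. mul_lam (f x)) p = mul_lam (subst_op mul_mu f p)"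
    and "subst_op mul_lam (\<lambda>x. mul_mu (f x)) p = mul_mu (subst_op mul_lam f p)"
    and "subst_op mul_lam (\<lambda>x. mul_lam (f x)) p = mul_lam (subst_op mul_lam f p)"
  by (simp_all add: subst_op_commute[where S = mul_lam] subst_op_commute[where S = mul_mu] mul_commute additive_intros)

lemma subst_op_mul_D:
  "subst_op mul_lam (\<lambda>x. mul_D (f x)) p = mul_D (subst_op mul_lam f p)"
  "subst_op mul_mu (\<lambda>x. mul_D (f x)) p = mul_D (subst_op mul_mu f p)"
  by (rule subst_op_commute[where S = mul_D, OF additive_mul_D], simp add: mul_D_commute)+

lemmas mul_simps = mul_commute mul_D_commute
  additive_mul_D[THEN additive.add] additive_mul_D[THEN additive.minus]
  additive_mul_lam[THEN additive.add] additive_mul_lam[THEN additive.minus]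
  additive_mul_mu[THEN additive.add] additive_mul_mu[THEN additive.minus]

lemmas in_simps = in_shift in_mul_D
  in_additive[THEN additive.add] in_additive[THEN additive.minus] in_additive[THEN additive.zero]

section \<open>The \<open>\<lambda>\<close>-bracket\<close>

context gelfand_dorfman_algebra
begin

lemmas nov_additive = bilinear_mapD(1,2)[OF nov_bilinear]
lemmas lie_additive = bilinear_mapD(1,2)[OF lie_bilinear]
lemmas nov_scale = bilinear_mapD(3,4)[OF nov_bilinear]
lemmas lie_scale = bilinear_mapD(3,4)[OF lie_bilinear]

lemmas nov_simps [simp] =
  nov_additive[THEN additive.add] nov_additive[THEN additive.minus] nov_additive[THEN additive.zero]
lemmas lie_simps [simp] =
  lie_additive[THEN additive.add] lie_additive[THEN additive.minus] lie_additive[THEN additive.zero]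

lemma lie_skew: "lie a b = - lie b a"
proof -
  have "lie (a + b) (a + b) = lie a b + lie b a"
    by (simp add: lie_alternating[of a] lie_alternating[of b] add.commute)
  then show ?thesis
    by (simp only: lie_alternating eq_neg_iff_add_eq_0)
qed

abbreviation br :: "'a poly \<Rightarrow> 'a poly \<Rightarrow> 'a poly poly" where "br \<equiv> R_bracket nov lie"

lemma R_bracket_gen_additive: "additive (R_bracket_gen nov lie a)" "additive (\<lambda>a. R_bracket_gen nov lie a b)"
  by (auto simp: additive_def R_bracket_gen_def algebra_simps)

lemma br_eq: "br = sesquilinear_extension (\<lambda>p. - pCons 0 p) lam_plus_D (R_bracket_gen nov lie)"
  by (intro ext) (simp add: R_bracket_def sesquilinear_extension_def)

lemma sesquilinear_br: "sesquilinear (\<lambda>p. - pCons 0 p) lam_plus_D br"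
  unfolding br_eq
  by (intro sesquilinear_sesquilinear_extension additive_lam_plus_D additive_minus_pCons
      R_bracket_gen_additive minus_pCons_commute)

lemma br_const: "br [:a:] [:b:] = R_bracket_gen nov lie a b"
  unfolding br_eq
  by (intro sesquilinear_extension_const additive_lam_plus_D additive_minus_pCons
      R_bracket_gen_additive minus_pCons_commute)

lemma br_additive: "additive (br x)" "additive (\<lambda>x. br x y)"
  and br_shift: "br (pCons 0 x) y = - pCons 0 (br x y)" "br x (pCons 0 y) = lam_plus_D (br x y)"
  using sesquilinear_br by (auto simp: sesquilinear_def)

lemma br_scale_left: "br (map_poly (scale c) x) y = map_poly (map_poly (scale c)) (br x y)"
proof (rule sesquilinear_ext[where F = "\<lambda>x y. br (map_poly (scale c) x) y"])
  have a: "additive (scale c)" by (simp add: additive_def scale_right_distrib)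
  note aa = additive_map_poly[OF a] additive_map_poly[OF additive_map_poly[OF a]]
  show "sesquilinear (\<lambda>p. - pCons 0 p) lam_plus_D (\<lambda>x y. br (map_poly (scale c) x) y)"
    unfolding sesquilinear_def
    by (simp add: br_additive additive_comp[OF br_additive(2)] aa br_shift map_poly_pCons)
  show "sesquilinear (\<lambda>p. - pCons 0 p) lam_plus_D (\<lambda>x y. map_poly (map_poly (scale c)) (br x y))"
    unfolding sesquilinear_def
    by (simp add: additive_comp[OF aa(2)] br_additive aa(2)[THEN additive.add]
       aa(2)[THEN additive.minus]  br_shift map_poly_pCons map_poly_pCons_commute)
  show "br (map_poly (scale c) [:a:]) [:b:] = map_poly (map_poly (scale c)) (br [:a:] [:b:])" for a b
    by (simp add: br_const R_bracket_gen_def map_poly_pCons nov_scale lie_scale scale_right_distrib)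
qed

lemma br_scale_right: "br x (map_poly (scale c) y) = map_poly (map_poly (scale c)) (br x y)"
proof (rule sesquilinear_ext[where F = "\<lambda>x y. br x (map_poly (scale c) y)"])
  have a: "additive (scale c)" by (simp add: additive_def scale_right_distrib)
  note aa = additive_map_poly[OF a] additive_map_poly[OF additive_map_poly[OF a]]
  show "sesquilinear (\<lambda>p. - pCons 0 p) lam_plus_D (\<lambda>x y. br x (map_poly (scale c) y))"
    unfolding sesquilinear_def
    by (simp add: br_additive additive_comp[OF br_additive(1)] aa br_shift map_poly_pCons)
  show "sesquilinear (\<lambda>p. - pCons 0 p) lam_plus_D (\<lambda>x y. map_poly (map_poly (scale c)) (br x y))"
    unfolding sesquilinear_def
    by (simp add: additive_comp[OF aa(2)] br_additive aa(2)[THEN additive.add]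
       aa(2)[THEN additive.minus]  br_shift map_poly_pCons map_poly_pCons_commute)
  show "br [:a:] (map_poly (scale c) [:b:]) = map_poly (map_poly (scale c)) (br [:a:] [:b:])" for a b
    by (simp add: br_const R_bracket_gen_def map_poly_pCons nov_scale lie_scale scale_right_distrib)
qed

lemmas br_simps = br_shift br_additive[THEN additive.add] br_additive[THEN additive.minus]
  br_additive[THEN additive.zero]

lemma br_pCons:
  "br (pCons a x) y = br [:a:] y - pCons 0 (br x y)"
  "br x (pCons b y) = br x [:b:] + lam_plus_D (br x y)"
proof -
  have "pCons a x = [:a:] + pCons 0 x" "pCons b y = [:b:] + pCons 0 y" by simp_all
  then show "br (pCons a x) y = br [:a:] y - pCons 0 (br x y)"
    "br x (pCons b y) = br x [:b:] + lam_plus_D (br x y)"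
    by (simp_all only: br_simps diff_conv_add_uminus)
qed

text \<open>
  Applying \<open>\<partial>\<close> to \<open>x\<close> multiplies \<open>[y\<^sub>\<lambda> x]\<close> by \<open>\<lambda> + \<partial>\<close>; after \<open>\<lambda>\<close> has been
  replaced by \<open>- \<lambda> - \<partial>\<close> this becomes \<open>- \<lambda>\<close>, as required on the left-hand side. On \<open>A\<close>
  the identity reduces to skew-symmetry of the Lie bracket.
\<close>
lemma R_bracket_skew: "br x y = - subst_op (\<lambda>p. - pCons 0 p - map_poly (pCons 0) p) (\<lambda>x. [:x:]) (br y x)"
proof -
  define T where "T p = - pCons 0 p - map_poly (pCons 0) p" for p :: "'a poly poly"
  have T: "additive T" unfolding T_def by (intro additive_intros)
  have m: "additive (map_poly (pCons 0) :: 'a poly poly \<Rightarrow> _)" by (intro additive_intros)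
  note ms = m[THEN additive.add] m[THEN additive.diff] m[THEN additive.minus]
  let ?S = "subst_op T (\<lambda>x. [:x:])"
  have S: "additive ?S"
    by (intro additive_subst_op T additive_intros)
  note Ss = S[THEN additive.add] S[THEN additive.minus]
  have D: "?S (map_poly (pCons 0) p) = map_poly (pCons 0) (?S p)" for p
  proof -
    have "?S (map_poly (pCons 0) p) = subst_op T (\<lambda>x. map_poly (pCons 0) [:x:]) p"
      by (simp add: subst_op_map_poly[OF T] map_poly_pCons)
    also have "\<dots> = map_poly (pCons 0) (?S p)"
      by (rule subst_op_commute[OF m]) (simp only: ms T_def, simp add: map_poly_pCons)
    finally show ?thesis .
  qed
  have "br x y = - ?S (br y x)"
  proof (rule sesquilinear_ext[OF sesquilinear_br, where G = "\<lambda>x y. - ?S (br y x)"])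
    show "sesquilinear (\<lambda>p. - pCons 0 p) lam_plus_D (\<lambda>x y. - ?S (br y x))"
      unfolding sesquilinear_def
    proof (intro conjI allI)
      show "additive (\<lambda>x. - ?S (br y x))" "additive (\<lambda>y. - ?S (br y x))" for x y
        by (intro additive_uminus additive_comp[OF S] br_additive)+
      show "- ?S (br y (pCons 0 x)) = - pCons 0 (- ?S (br y x))" for x y
        by (simp add: br_shift Ss subst_op_shift[OF T] D) (simp add: T_def)
      show "- ?S (br (pCons 0 y) x) = lam_plus_D (- ?S (br y x))" for x y
        by (simp add: br_shift Ss subst_op_shift[OF T] D ms)
          (simp add: T_def ms additive.minus[OF additive_pCons_0] del: minus_pCons)
    qed
    show "br [:a:] [:b:] = - ?S (br [:b:] [:a:])" for a b
      by (simp add: br_const R_bracket_gen_def subst_op_pCons[OF T])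
        (simp add: T_def map_poly_pCons lie_skew[of a b])
  qed
  then show ?thesis unfolding T_def .
qed

text \<open>
  The three terms of the Jacobi identity, named so that each can be shown to be additive and to obey
  the same rule as the others when \<open>\<partial>\<close> is applied to one of the arguments.
\<close>
definition jacobi_lhs where "jacobi_lhs a b c = subst_op mul_mu (\<lambda>x. in_lam (br a x)) (br b c)"
definition jacobi_rhs1 where "jacobi_rhs1 a b c = subst_op mul_lam (\<lambda>x. in_lam_plus_mu (br x c)) (br a b)"
definition jacobi_rhs2 where "jacobi_rhs2 a b c = subst_op mul_lam (\<lambda>x. in_mu (br b x)) (br a c)"

lemma jacobi_inner_additive:
  "additive (\<lambda>x. in_lam (br a x))" "additive (\<lambda>x. in_lam_plus_mu (br x a))" "additive (\<lambda>x. in_mu (br a x))"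
  by (intro additive_comp[OF in_additive(1)] additive_comp[OF in_additive(2)] additive_comp[OF in_additive(3)] br_additive)+

lemma jacobi_outer_additive:
  "additive (subst_op mul_mu (\<lambda>x. in_lam (br a x)))"
  "additive (subst_op mul_lam (\<lambda>x. in_lam_plus_mu (br x a)))"
  "additive (subst_op mul_lam (\<lambda>x. in_mu (br a x)))"
  by (intro additive_subst_op additive_intros jacobi_inner_additive)+

lemmas jacobi_outer_simps = jacobi_outer_additive[THEN additive.add] jacobi_outer_additive[THEN additive.minus]

lemma jacobi_additive:
  "additive (\<lambda>a. jacobi_lhs a b c)" "additive (\<lambda>b. jacobi_lhs a b c)" "additive (\<lambda>c. jacobi_lhs a b c)"
  "additive (\<lambda>a. jacobi_rhs1 a b c)" "additive (\<lambda>b. jacobi_rhs1 a b c)" "additive (\<lambda>c. jacobi_rhs1 a b c)"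
  "additive (\<lambda>a. jacobi_rhs2 a b c)" "additive (\<lambda>b. jacobi_rhs2 a b c)" "additive (\<lambda>c. jacobi_rhs2 a b c)"
  unfolding additive_def jacobi_lhs_def jacobi_rhs1_def jacobi_rhs2_def
  by (simp_all add: br_simps jacobi_outer_simps in_simps subst_op_fun_add additive_intros)

lemmas jacobi_shift_simps = br_simps jacobi_outer_simps in_simps subst_op_fun_add subst_op_fun_diff additive_intros
  subst_op_shift subst_op_map_poly subst_op_fun_uminus subst_op_mul subst_op_mul_D mul_simps

lemma jacobi_shift_left:
  "jacobi_lhs (pCons 0 a) b c = - mul_lam (jacobi_lhs a b c)"
  "jacobi_rhs1 (pCons 0 a) b c = - mul_lam (jacobi_rhs1 a b c)"
  "jacobi_rhs2 (pCons 0 a) b c = - mul_lam (jacobi_rhs2 a b c)"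
  unfolding jacobi_lhs_def jacobi_rhs1_def jacobi_rhs2_def
  by (simp_all add: jacobi_shift_simps)

text \<open>
  In the first term on the right, \<open>[a\<^sub>\<lambda> \<partial> b]\<close> contributes the factor \<open>\<lambda> + \<partial>\<close>, and
  \<open>\<partial>\<close> turns into \<open>- (\<lambda> + \<mu>)\<close> in the outer bracket; the sum is \<open>- \<mu>\<close>.
\<close>
lemma jacobi_shift_mid:
  "jacobi_lhs a (pCons 0 b) c = - mul_mu (jacobi_lhs a b c)"
  "jacobi_rhs1 a (pCons 0 b) c = - mul_mu (jacobi_rhs1 a b c)"
  "jacobi_rhs2 a (pCons 0 b) c = - mul_mu (jacobi_rhs2 a b c)"
  unfolding jacobi_lhs_def jacobi_rhs1_def jacobi_rhs2_def
  by (simp_all add: jacobi_shift_simps)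

lemma jacobi_shift_right:
  "jacobi_lhs a b (pCons 0 c) = mul_lam (jacobi_lhs a b c) + mul_mu (jacobi_lhs a b c) + mul_D (jacobi_lhs a b c)"
  "jacobi_rhs1 a b (pCons 0 c) = mul_lam (jacobi_rhs1 a b c) + mul_mu (jacobi_rhs1 a b c) + mul_D (jacobi_rhs1 a b c)"
  "jacobi_rhs2 a b (pCons 0 c) = mul_lam (jacobi_rhs2 a b c) + mul_mu (jacobi_rhs2 a b c) + mul_D (jacobi_rhs2 a b c)"
  unfolding jacobi_lhs_def jacobi_rhs1_def jacobi_rhs2_def
  by (simp_all add: jacobi_shift_simps algebra_simps)

text \<open>
  The coefficients of the monomials in \<open>\<partial>\<close>, \<open>\<lambda>\<close>, \<open>\<mu>\<close> give ten identities in \<open>A\<close>. The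
  constant one is the Jacobi identity of \<open>A\<close>, the linear ones mix both products, and the quadratic
  ones involve the Novikov product only.
\<close>
lemma R_bracket_jacobi_const: "jacobi_lhs [:a:] [:b:] [:c:] = jacobi_rhs1 [:a:] [:b:] [:c:] + jacobi_rhs2 [:a:] [:b:] [:c:]"
proof -
  \<comment> \<open>The compatibility axiom and left symmetry are oriented as rewrite rules that terminate for
    the three given elements.\<close>
  have c_ab: "c \<cdot> lie a b = lie a (c \<cdot> b) - lie b (c \<cdot> a) + lie b c \<cdot> a - lie a c \<cdot> b"
    using gd_compat[of c a b] lie_skew[of "c \<cdot> a" b] lie_skew[of "c \<cdot> b" a] lie_skew[of c a] lie_skew[of c b]
    by (simp add: algebra_simps)
  have a_bc: "a \<cdot> lie b c = lie (a \<cdot> b) c + lie b (a \<cdot> c) + lie a b \<cdot> c - lie a c \<cdot> b"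
    using gd_compat[of a b c] lie_skew[of "a \<cdot> c" b]
    by (simp add: algebra_simps)
  have b_ac: "b \<cdot> lie a c = lie (b \<cdot> a) c + lie a (b \<cdot> c) - lie a b \<cdot> c - lie b c \<cdot> a"
    using gd_compat[of b a c] lie_skew[of "b \<cdot> c" a] lie_skew[of b a]
    by (simp add: algebra_simps)
  have right_commute: "c \<cdot> b \<cdot> a = c \<cdot> a \<cdot> b" "a \<cdot> c \<cdot> b = a \<cdot> b \<cdot> c" "b \<cdot> c \<cdot> a = b \<cdot> a \<cdot> c"
    by (rule nov_right_commute)+
  have left_symmetric:
    "a \<cdot> (c \<cdot> b) = a \<cdot> b \<cdot> c - c \<cdot> a \<cdot> b + c \<cdot> (a \<cdot> b)"
    "b \<cdot> (c \<cdot> a) = b \<cdot> a \<cdot> c - c \<cdot> a \<cdot> b + c \<cdot> (b \<cdot> a)"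
    "a \<cdot> (b \<cdot> c) = a \<cdot> b \<cdot> c - b \<cdot> a \<cdot> c + b \<cdot> (a \<cdot> c)"
    using nov_left_symmetric[of a c b] nov_left_symmetric[of b c a] nov_left_symmetric[of a b c]
    by (simp_all add: right_commute algebra_simps)
  note expand = br_const R_bracket_gen_def in_simps mul_lam_def mul_mu_def map_poly_pCons
  show ?thesis
    unfolding jacobi_lhs_def jacobi_rhs1_def jacobi_rhs2_def
    apply (simp add: expand subst_op_pCons additive_pCons_0 additive_mul_lam[unfolded mul_lam_def] br_simps jacobi_inner_additive[THEN additive.zero])
    \<comment> \<open>Only pairs \<open>[:u, v:]\<close> are split here: splitting a constant \<open>[:u:]\<close> again would not
      terminate.\<close>
    apply (simp add: expand in_lam_eq in_mu_eq in_lam_plus_mu_pCons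
        br_pCons(1)[of _ "[:u:]" for u] br_pCons(2)[of _ _ "[:u:]" for u])
    apply (intro conjI)
    by (simp_all add: lie_jacobi[of a b c] right_commute left_symmetric c_ab a_bc b_ac algebra_simps)
qed

lemma R_bracket_jacobi: "jacobi_lhs x y z = jacobi_rhs1 x y z + jacobi_rhs2 x y z"
proof (rule poly_ext[where F = "\<lambda>z. jacobi_lhs x y z" and G = "\<lambda>z. jacobi_rhs1 x y z + jacobi_rhs2 x y z"
      and S = "\<lambda>p. mul_lam p + mul_mu p + mul_D p"])
  fix c
  show "jacobi_lhs x y [:c:] = jacobi_rhs1 x y [:c:] + jacobi_rhs2 x y [:c:]"
    by (rule sesquilinear_ext[where F = "\<lambda>x y. jacobi_lhs x y [:c:]" and G = "\<lambda>x y. jacobi_rhs1 x y [:c:] + jacobi_rhs2 x y [:c:]"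
          and S = "\<lambda>p. - mul_lam p" and T = "\<lambda>p. - mul_mu p"])
      (simp_all add: sesquilinear_def jacobi_additive additive_plus jacobi_shift_left jacobi_shift_mid mul_simps R_bracket_jacobi_const)
qed (simp_all add: jacobi_additive additive_plus jacobi_shift_right mul_simps ac_simps)


lemma R_lie_conformal_algebra:
  assumes "module (R_act scale)"
  shows "lie_conformal_algebra (R_act scale) br"
proof -
  note vs = vector_space_map_poly[OF vector_space_axioms]
  show ?thesis
  proof (intro lie_conformal_algebra.intro lie_conformal_algebra_axioms.intro assms,
      unfold R_act_eqs[OF vector_space_axioms])
    show "bilinear_map (\<lambda>c. map_poly (scale c)) (\<lambda>c. map_poly (scale c))
      (\<lambda>c. map_poly (map_poly (scale c))) br"
      by (intro bilinear_mapI vs vector_space_map_poly[OF vs] br_additive br_scale_left br_scale_right)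
  qed (rule br_shift R_bracket_skew R_bracket_jacobi[unfolded jacobi_lhs_def jacobi_rhs1_def jacobi_rhs2_def])+
qed

text \<open>
  On \<open>A\<close> the coefficients at \<open>\<partial>\<close> and at \<open>1\<close> are the Rota-Baxter identities for the two
  products, and the coefficient at \<open>\<lambda>\<close> is the sum of two Novikov ones.
\<close>
lemma rota_baxter_bracket_iff:
  assumes "Vector_Spaces.linear scale scale b"
  shows "(\<forall>x y. br (map_poly b x) (map_poly b y) =
       map_poly (map_poly b)
         (br (map_poly b x) y + br x (map_poly b y) + map_poly (map_poly (scale \<theta>)) (br x y))) \<longleftrightarrow>
     rota_baxter_identity scale \<theta> b nov \<and> rota_baxter_identity scale \<theta> b lie"
    (is "(\<forall>x y. ?L x y = ?R x y) \<longleftrightarrow> ?N \<and> ?l")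
proof -
  have b: "additive b" and scale: "additive (scale \<theta>)"
    using assms by (simp_all add: Vector_Spaces.linear_iff additive_def scale_right_distrib)
  have b': "additive (map_poly b)" "additive (map_poly (map_poly b))"
    and scale': "additive (map_poly (map_poly (scale \<theta>)))"
    by (intro additive_map_poly b scale)+
  note b_simps = b[THEN additive.zero] b[THEN additive.add] b'[THEN additive.add] b'[THEN additive.minus] b'[THEN additive.diff]
    scale'[THEN additive.add] scale'[THEN additive.minus]
  have gen: "?L [:u:] [:v:] = ?R [:u:] [:v:] \<longleftrightarrow>
    lie (b u) (b v) = b (lie (b u) v + lie u (b v) + scale \<theta> (lie u v)) \<and>
    b v \<cdot> b u = b (b v \<cdot> u + v \<cdot> b u + scale \<theta> (v \<cdot> u)) \<and>
    b u \<cdot> b v + b v \<cdot> b u = b (b u \<cdot> v + u \<cdot> b v + scale \<theta> (u \<cdot> v)) + b (b v \<cdot> u + v \<cdot> b u + scale \<theta> (v \<cdot> u))"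
    for u v
    by (auto simp: map_poly_pCons b_simps br_const R_bracket_gen_def scale_right_distrib algebra_simps)
  have "sesquilinear (\<lambda>p. - pCons 0 p) lam_plus_D ?L"
    unfolding sesquilinear_def
    by (simp add: map_poly_pCons b_simps br_shift additive_comp[OF br_additive(1)]
        additive_comp[OF br_additive(2)] b')
  moreover have "sesquilinear (\<lambda>p. - pCons 0 p) lam_plus_D ?R"
    unfolding sesquilinear_def
    by (simp add: additive_def map_poly_pCons b_simps br_simps map_poly_pCons_commute algebra_simps
        additive_map_poly[OF additive_pCons_0, THEN additive.add])
  ultimately have "(\<forall>x y. ?L x y = ?R x y) \<longleftrightarrow> (\<forall>u v. ?L [:u:] [:v:] = ?R [:u:] [:v:])"
    using sesquilinear_ext[of _ _ ?L ?R] by blast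
  also have "\<dots> \<longleftrightarrow> ?N \<and> ?l"
    unfolding gen rota_baxter_identity_def by auto
  finally show ?thesis .
qed

end

section \<open>The conformal bilinear form\<close>

text \<open>
  The map \<open>T\<close> lists the values of \<open>form a\<close> on the basis as coordinates of a vector. It is an
  injective endomorphism by non-degeneracy, hence surjective, so the coordinates may be prescribed to
  be the values of \<open>\<phi>\<close>. Working with an endomorphism avoids the dual space as a vector space.
\<close>
lemma (in finite_dimensional_vector_space) functional_representation:
  assumes form: "bilinear_map scale scale (*) form"
    and nondegenerate: "\<And>a. (\<And>b. form a b = 0) \<Longrightarrow> a = 0"
    and \<phi>: "Vector_Spaces.linear scale (*) \<phi>"
  obtains a where "\<And>b. form a b = \<phi> b"
proof -
  have form_linear: "Vector_Spaces.linear scale (*) (form a)" for a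
    using form by (simp add: bilinear_map_def)
  have eqI: "f b = g b"
    if "Vector_Spaces.linear scale (*) f" "Vector_Spaces.linear scale (*) g"
      "\<And>e. e \<in> Basis \<Longrightarrow> f e = g e" for f g :: "'b \<Rightarrow> 'a" and b
  proof -
    interpret vector_space_pair scale "(*) :: 'a \<Rightarrow> 'a \<Rightarrow> 'a"
      using that(1) by (simp add: vector_space_pair_def Vector_Spaces.linear_iff)
    show ?thesis
      using linear_eq_on[OF that(1,2), of b Basis] that(3) span_Basis by auto
  qed
  define T where "T a = (\<Sum>e\<in>Basis. scale (form a e) e)" for a
  have coords: "f = g" if "(\<Sum>e\<in>Basis. scale (f e) e) = (\<Sum>e\<in>Basis. scale (g e) e)"
    "Vector_Spaces.linear scale (*) f" "Vector_Spaces.linear scale (*) g" for f g :: "'b \<Rightarrow> 'a"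
  proof
    have "(\<Sum>e\<in>Basis. scale (f e - g e) e) = 0"
      using that(1) by (simp add: scale_left_diff_distrib sum_subtractf)
    then have "f e - g e = 0" if "e \<in> Basis" for e
      using independentD[OF independent_Basis finite_Basis subset_refl _ that, of "\<lambda>e. f e - g e"] by simp
    then show "f b = g b" for b
      using that(2,3) eqI by simp
  qed
  have T_linear: "Vector_Spaces.linear scale scale T"
    using bilinear_mapD[OF form] unfolding T_def
    by (auto simp: Vector_Spaces.linear_iff additive_def scale_left_distrib sum.distrib scale_sum_right)
  have "inj T"
  proof (subst module_hom.inj_iff_eq_0[OF T_linear[unfolded Vector_Spaces.linear_def, THEN conjunct2, THEN conjunct2]], intro allI impI)
    fix a assume "T a = 0"
    then have "form a = (\<lambda>_. 0)"
      by (intro coords form_linear) (use form_linear[of a] in \<open>simp_all add: T_def Vector_Spaces.linear_iff\<close>)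
    then show "a = 0" using nondegenerate by simp
  qed
  then have "surj T"
    using linear_inj_imp_surj[OF T_linear] by blast
  then obtain a where "(\<Sum>e\<in>Basis. scale (\<phi> e) e) = T a" by (metis surjD)
  then have "form a = \<phi>"
    by (intro coords form_linear \<phi>) (simp add: T_def)
  then show ?thesis by (intro that[of a]) simp
qed

context
  fixes scale :: "'k::field_char_0 \<Rightarrow> 'a::ab_group_add \<Rightarrow> 'a" and form :: "'a \<Rightarrow> 'a \<Rightarrow> 'k"
  assumes form: "bilinear_map scale scale (*) form"
begin

interpretation vector_space scale
  by (rule bilinear_mapD(5)[OF form])

lemmas form_additive = bilinear_mapD(1,2)[OF form]
lemmas form_scale = bilinear_mapD(3,4)[OF form]
lemmas form_simps = form_additive[THEN additive.add] form_additive[THEN additive.minus]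
  form_additive[THEN additive.zero]

lemma sesquilinear_R_form: "sesquilinear (\<lambda>p. - pCons 0 p) (pCons 0) (R_form form)"
  and R_form_const: "R_form form [:a:] [:b:] = [:form a b:]"
proof -
  have R_form: "R_form form = sesquilinear_extension (\<lambda>p. - pCons 0 p) (pCons 0) (\<lambda>a b. [:form a b:])"
    by (intro ext) (simp add: R_form_def sesquilinear_extension_def)
  show "sesquilinear (\<lambda>p. - pCons 0 p) (pCons 0) (R_form form)"
    unfolding R_form
    by (intro sesquilinear_sesquilinear_extension additive_intros; simp add: additive_def form_simps)
  show "R_form form [:a:] [:b:] = [:form a b:]"
    unfolding R_form
    by (subst sesquilinear_extension_const) (simp_all add: additive_def form_simps)
qed

lemma R_form_additive: "additive (R_form form x)" "additive (\<lambda>x. R_form form x y)"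
  and R_form_shift: "R_form form (pCons 0 x) y = - pCons 0 (R_form form x y)"
    "R_form form x (pCons 0 y) = pCons 0 (R_form form x y)"
  using sesquilinear_R_form by (auto simp: sesquilinear_def)

lemmas R_form_simps = R_form_shift R_form_additive[THEN additive.add]
  R_form_additive[THEN additive.minus] R_form_additive[THEN additive.zero]

lemma R_form_scale:
  "R_form form (map_poly (scale c) x) y = smult c (R_form form x y)"
  "R_form form x (map_poly (scale c) y) = smult c (R_form form x y)"
proof -
  have a: "additive (scale c)" by (simp add: additive_def scale_right_distrib)
  note a' = additive_map_poly[OF a]
  have smult: "sesquilinear (\<lambda>p. - pCons 0 p) (pCons 0) (\<lambda>x y. smult c (R_form form x y))"
    unfolding sesquilinear_def
    by (simp add: additive_def R_form_simps smult_add_right)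
  show "R_form form (map_poly (scale c) x) y = smult c (R_form form x y)"
    by (rule sesquilinear_ext[OF _ smult, where F = "\<lambda>x y. R_form form (map_poly (scale c) x) y"])
      (simp_all add: sesquilinear_def additive_def R_form_simps a'[THEN additive.add] map_poly_pCons
        R_form_const form_scale)
  show "R_form form x (map_poly (scale c) y) = smult c (R_form form x y)"
    by (rule sesquilinear_ext[OF _ smult, where F = "\<lambda>x y. R_form form x (map_poly (scale c) y)"])
      (simp_all add: sesquilinear_def additive_def R_form_simps a'[THEN additive.add] map_poly_pCons
        R_form_const form_scale)
qed

lemma conformal_bilinear_form_R_form: "conformal_bilinear_form (R_act scale) (R_form form)"
  unfolding conformal_bilinear_form_def R_act_eqs[OF vector_space_axioms]
  by (intro conjI bilinear_mapI vector_space_map_poly vector_space_axioms vector_space_smult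
      R_form_additive R_form_scale) (simp_all add: R_form_shift)

lemma conformal_symmetric_R_form_iff:
  "conformal_symmetric (R_form form) \<longleftrightarrow> (\<forall>a b. form a b = form b a)"
proof
  assume "conformal_symmetric (R_form form)"
  then have "R_form form [:a:] [:b:] = pcompose (R_form form [:b:] [:a:]) [:0, -1:]" for a b
    unfolding conformal_symmetric_def by blast
  then show "\<forall>a b. form a b = form b a"
    by (simp add: R_form_const)
next
  assume sym: "\<forall>a b. form a b = form b a"
  have "R_form form x y = pcompose (R_form form y x) [:0, -1:]" for x y
    by (rule sesquilinear_ext[OF sesquilinear_R_form, where G = "\<lambda>x y. pcompose (R_form form y x) [:0, -1:]"])
      (use sym in \<open>simp_all add: sesquilinear_def additive_def R_form_simps pcompose_add pcompose_pCons
        pcompose_uminus R_form_const\<close>)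
  then show "conformal_symmetric (R_form form)"
    unfolding conformal_symmetric_def by blast
qed

lemma R_form_rota_baxter_iff:
  assumes b: "additive b"
  shows "(\<forall>x y. R_form form x (map_poly b y) + R_form form (map_poly b x) y + smult \<theta> (R_form form x y) = 0) \<longleftrightarrow>
     (\<forall>u v. form (b u) v + form u (b v) + \<theta> * form u v = 0)"
    (is "(\<forall>x y. ?F x y = 0) \<longleftrightarrow> _")
proof -
  note b_simps = b[THEN additive.zero] b[THEN additive_map_poly, THEN additive.add]
  have "sesquilinear (\<lambda>p. - pCons 0 p) (pCons 0) ?F"
    unfolding sesquilinear_def
    by (simp add: additive_def R_form_simps b_simps map_poly_pCons smult_add_right algebra_simps)
  moreover have "sesquilinear (\<lambda>p. - pCons 0 p) (pCons 0) (\<lambda>x y. 0)"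
    by (simp add: sesquilinear_def additive_def)
  ultimately have "(\<forall>x y. ?F x y = 0) \<longleftrightarrow> (\<forall>u v. ?F [:u:] [:v:] = 0)"
    using sesquilinear_ext[of _ _ ?F "\<lambda>x y. 0"] by blast
  also have "\<dots> \<longleftrightarrow> (\<forall>u v. form (b u) v + form u (b v) + \<theta> * form u v = 0)"
    by (simp add: R_form_const map_poly_pCons b_simps algebra_simps)
  finally show ?thesis .
qed

text \<open>
  Both sides are polynomials in the action of \<open>\<partial>\<close>, which is multiplication by \<open>- \<lambda>\<close> on
  either side.
\<close>
lemma R_form_act: "R_form form (R_act scale q x) = conformal_dual_act q (R_form form x)"
proof
  fix y
  show "R_form form (R_act scale q x) y = conformal_dual_act q (R_form form x) y"
    unfolding conformal_dual_act_def
  proof (induction q)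
    case 0
    have "R_act scale 0 x = 0"
      using R_act_const[OF vector_space_axioms, of 0 x] by (simp add: poly_eq_iff coeff_map_poly)
    then show ?case by (simp add: R_form_simps)
  next
    case (pCons c q)
    then show ?case
      by (simp add: R_act_pCons[OF vector_space_axioms] R_form_simps R_form_scale pcompose_pCons algebra_simps)
  qed
qed

lemma R_form_in_conformal_dual: "R_form form x \<in> conformal_dual (R_act scale)"
  unfolding conformal_dual_def R_act_eqs[OF vector_space_axioms]
  by (simp add: Vector_Spaces.linear_iff vector_space_map_poly vector_space_axioms vector_space_smult
      R_form_simps R_form_scale)

end

text \<open>
  Elements of the conformal dual are determined by their values on \<open>A\<close>. On \<open>A\<close>, the element
  \<open>\<Sum>\<^sub>n (- \<partial>)\<^sup>n r\<^sub>n\<close> has the values \<open>\<Sum>\<^sub>n \<lambda>\<^sup>n (r\<^sub>n, b)\<close>. So injectivity is the condition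
  that \<open>a \<mapsto> (a, \<cdot>)\<close> has trivial kernel, and surjectivity follows from it by representing each
  coefficient functional.
\<close>
lemma conformal_nondegenerate_R_form_iff:
  fixes scale :: "'k::field_char_0 \<Rightarrow> 'a::ab_group_add \<Rightarrow> 'a"
  assumes "finite_dimensional_vector_space scale Basis"
    and form: "bilinear_map scale scale (*) form"
  shows "conformal_nondegenerate (R_act scale) (R_form form) \<longleftrightarrow>
    (\<forall>a. (\<forall>b. form a b = 0) \<longrightarrow> a = 0)"
proof
  interpret finite_dimensional_vector_space scale Basis by fact
  let ?\<omega> = "R_form form"
  note R_simps = R_form_simps[OF form] R_form_const[OF form]
  have ext: "f = g" if "f \<in> conformal_dual (R_act scale)" "g \<in> conformal_dual (R_act scale)"
    "\<And>a. f [:a:] = g [:a:]" for f g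
  proof
    show "f x = g x" for x
      by (rule poly_ext[where F = f and G = g and S = "pCons 0"])
        (use that in \<open>simp_all add: conformal_dual_def R_act_eqs[OF vector_space_axioms] Vector_Spaces.linear_iff additive_def\<close>)
  qed
  {
    assume nd: "conformal_nondegenerate (R_act scale) ?\<omega>"
    show "\<forall>a. (\<forall>b. form a b = 0) \<longrightarrow> a = 0"
    proof (intro allI impI)
      fix a assume "\<forall>b. form a b = 0"
      then have "?\<omega> [:a:] = ?\<omega> 0"
        by (intro ext R_form_in_conformal_dual form) (simp add: R_simps)
      moreover have "inj ?\<omega>"
        using nd by (simp add: conformal_nondegenerate_def bij_betw_def)
      ultimately show "a = 0" by (simp add: inj_eq)
    qed
  next
    assume nd: "\<forall>a. (\<forall>b. form a b = 0) \<longrightarrow> a = 0"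
    have zero: "x = 0" if "\<And>b. ?\<omega> x [:b:] = 0" for x
      using that
    proof (induction x)
      \<comment> \<open>The values on \<open>A\<close> of \<open>a + \<partial> x\<close> have constant term \<open>(a, b)\<close> and are otherwise
        those of \<open>x\<close> times \<open>- \<lambda>\<close>, so both parts vanish.\<close>
      case (pCons a x)
      have eq: "?\<omega> (pCons a x) [:b:] = pCons (form a b) (- ?\<omega> x [:b:])" for b
      proof -
        have "pCons a x = [:a:] + pCons 0 x" by simp
        then show ?thesis by (simp only: R_simps) simp
      qed
      have "form a b = 0 \<and> ?\<omega> x [:b:] = 0" for b
        using pCons.prems[of b] by (simp add: eq)
      then show ?case using nd pCons.IH by simp
    qed simp
    have "inj ?\<omega>"
    proof
      fix x y assume "?\<omega> x = ?\<omega> y"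
      then have "x - y = 0"
        by (intro zero) (simp add: additive.diff[OF R_form_additive(2)[OF form]])
      then show "x = y" by simp
    qed
    moreover have "\<exists>x. f = ?\<omega> x" if f: "f \<in> conformal_dual (R_act scale)" for f
    proof -
      have linear: "Vector_Spaces.linear (\<lambda>c. map_poly (scale c)) smult f"
        using f by (simp add: conformal_dual_def R_act_eqs[OF vector_space_axioms])
      then have f_add: "f (x + y) = f x + f y" and f_scale: "f (map_poly (scale c) x) = smult c (f x)" for x y c
        by (simp_all add: Vector_Spaces.linear_iff)
      have coeff_linear: "Vector_Spaces.linear scale (*) (\<lambda>a. coeff (f [:a:]) n)" for n
        using f_add[of "[:_:]" "[:_:]"] f_scale[of _ "[:_:]"] bilinear_mapD(5,7)[OF form]
        by (simp add: Vector_Spaces.linear_iff map_poly_pCons)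
      have "\<exists>a. \<forall>b. form a b = coeff (f [:b:]) n" for n
        by (rule functional_representation[OF form _ coeff_linear]) (use nd in auto)
      then obtain r where r: "\<And>n b. form (r n) b = coeff (f [:b:]) n" by metis
      \<comment> \<open>A common degree bound on the basis bounds the degree of \<open>f\<close> on all of \<open>A\<close>.\<close>
      obtain N where N: "\<And>e. e \<in> Basis \<Longrightarrow> degree (f [:e:]) \<le> N"
        using finite_Basis by (meson finite_imageI finite_nat_set_iff_bounded_le imageI)
      have deg: "coeff (f [:b:]) n = 0" if "n > N" for b n
      proof -
        interpret vector_space_pair scale "(*) :: 'k \<Rightarrow> 'k \<Rightarrow> 'k"
          using coeff_linear[of n] by (simp add: vector_space_pair_def Vector_Spaces.linear_iff)
        show ?thesis
          using linear_eq_on[OF coeff_linear linear_zero, of b Basis n] span_Basis N that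
          by (force simp: coeff_eq_0)
      qed
      have power: "?\<omega> (((\<lambda>p. - pCons 0 p) ^^ n) [:a:]) [:b:] = monom (form a b) n" for n a b
        by (induction n) (simp_all add: R_simps monom_0 monom_Suc)
      define x where "x = (\<Sum>n\<le>N. ((\<lambda>p. - pCons 0 p) ^^ n) [:r n:])"
      have "?\<omega> x [:b:] = f [:b:]" for b
        unfolding x_def additive.sum[OF R_form_additive(2)[OF form]] power
        by (rule poly_eqI) (simp add: coeff_sum coeff_monom r deg)
      then have "f = ?\<omega> x"
        by (intro ext f R_form_in_conformal_dual form) simp
      then show ?thesis ..
    qed
    ultimately have "bij_betw ?\<omega> UNIV (conformal_dual (R_act scale))"
      using R_form_in_conformal_dual[OF form] by (auto simp: bij_betw_def)
    then show "conformal_nondegenerate (R_act scale) ?\<omega>"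
      unfolding conformal_nondegenerate_def
      by (simp add: R_simps fun_eq_iff R_form_act[OF form])
  }
qed

text \<open>
  Applying \<open>\<partial>\<close> to the three arguments multiplies both sides of invariance by \<open>- \<mu>\<close>,
  \<open>\<mu> - \<lambda>\<close> and \<open>\<lambda>\<close>. On \<open>A\<close>, the coefficient at \<open>1\<close> is invariance for the Lie bracket
  and the one at \<open>\<lambda>\<close> is invariance for the Novikov product; the one at \<open>\<mu>\<close> follows from
  the latter, and this is where symmetry of the form enters.
\<close>
lemma (in gelfand_dorfman_algebra) conformal_invariant_R_form_iff:
  assumes form: "bilinear_map scale scale (*) form"
    and sym: "\<And>a b. form a b = form b a"
  shows "conformal_invariant br (R_form form) \<longleftrightarrow>
    (\<forall>a b c. form (lie a b) c = form a (lie b c)) \<and>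
    (\<forall>a b c. form (a \<cdot> b) c = - form b (a \<cdot> c + c \<cdot> a))"
proof -
  let ?\<omega> = "R_form form"
  let ?T = "\<lambda>p::'k poly poly. mul_lam p - mul_mu p"
  define I0 where "I0 x y z = subst_op mul_mu (\<lambda>w. in_lam (?\<omega> w z)) (br x y)" for x y z
  define I1 where "I1 x y z = subst_op ?T (\<lambda>w. in_mu (?\<omega> x w)) (br y z)" for x y z
  note form_R_simps = R_form_simps[OF form] form_simps[OF form]
  note form_R_additive = R_form_additive[OF form]
  have T: "additive ?T" by (intro additive_intros)
  have inner: "additive (\<lambda>w. in_lam (?\<omega> w z))" "additive (\<lambda>w. in_mu (?\<omega> z w))" for z
    by (intro additive_comp[OF in_additive(1)] additive_comp[OF in_additive(2)] form_R_additive)+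
  have outer: "additive (subst_op mul_mu (\<lambda>w. in_lam (?\<omega> w z)))"
    "additive (subst_op ?T (\<lambda>w. in_mu (?\<omega> z w)))" for z
    by (intro additive_subst_op additive_intros inner)+
  note outer_simps = outer[THEN additive.add] outer[THEN additive.minus]
  have I_additive: "additive (\<lambda>a. I0 a b c)" "additive (\<lambda>b. I0 a b c)" "additive (\<lambda>c. I0 a b c)"
    "additive (\<lambda>a. I1 a b c)" "additive (\<lambda>b. I1 a b c)" "additive (\<lambda>c. I1 a b c)" for a b c
    unfolding additive_def I0_def I1_def
    by (simp_all add: br_simps form_R_simps outer_simps in_additive[THEN additive.add]
        subst_op_fun_add additive_mul_mu T)
  have pull: "subst_op mul_mu (\<lambda>x. mul_lam (f x)) p = mul_lam (subst_op mul_mu f p)"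
    "subst_op ?T (\<lambda>x. mul_mu (f x)) p = mul_mu (subst_op ?T f p)"
    for f :: "'a poly \<Rightarrow> 'k poly poly" and p
    by (rule subst_op_mul(1)) (simp add: subst_op_commute[where S = mul_mu] additive_mul_mu
       additive_mul_mu[THEN additive.diff] mul_commute)
  note I_shift_simps = br_simps form_R_simps outer_simps in_shift
    in_additive(1,2)[THEN additive.add] in_additive(1,2)[THEN additive.minus]
    subst_op_shift subst_op_map_poly subst_op_fun_uminus[OF additive_mul_mu] subst_op_fun_uminus[OF T] pull
    additive_mul_mu T in_additive(1,2)[THEN additive.zero]
    additive_mul_mu[THEN additive.minus] additive_mul_lam[THEN additive.minus]
  have shift:
    "I0 (pCons 0 a) b c = - mul_mu (I0 a b c)" "I1 (pCons 0 a) b c = - mul_mu (I1 a b c)"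
    "I0 a (pCons 0 b) c = mul_mu (I0 a b c) - mul_lam (I0 a b c)"
    "I1 a (pCons 0 b) c = mul_mu (I1 a b c) - mul_lam (I1 a b c)"
    "I0 a b (pCons 0 c) = mul_lam (I0 a b c)" "I1 a b (pCons 0 c) = mul_lam (I1 a b c)" for a b c
    unfolding I0_def I1_def by (simp_all add: I_shift_simps)
  have "I0 x y z = I1 x y z" if "\<And>a b c. I0 [:a:] [:b:] [:c:] = I1 [:a:] [:b:] [:c:]" for x y z
  proof (rule poly_ext[where F = "\<lambda>z. I0 x y z" and G = "\<lambda>z. I1 x y z" and S = mul_lam])
    fix c
    show "I0 x y [:c:] = I1 x y [:c:]"
      by (rule sesquilinear_ext[where F = "\<lambda>x y. I0 x y [:c:]" and G = "\<lambda>x y. I1 x y [:c:]"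
          and S = "\<lambda>p. - mul_mu p" and T = "\<lambda>p. mul_mu p - mul_lam p"])
        (simp_all add: sesquilinear_def I_additive shift that)
  qed (simp_all add: I_additive shift)
  then have reduction: "conformal_invariant br ?\<omega> \<longleftrightarrow> (\<forall>a b c. I0 [:a:] [:b:] [:c:] = I1 [:a:] [:b:] [:c:])"
    unfolding conformal_invariant_def I0_def I1_def by blast
  have generators: "I0 [:a:] [:b:] [:c:] = I1 [:a:] [:b:] [:c:] \<longleftrightarrow>
     form (lie a b) c = form a (lie b c) \<and>
     form (b \<cdot> a) c = - form a (b \<cdot> c + c \<cdot> b) \<and>
     form (a \<cdot> b + b \<cdot> a) c = form a (c \<cdot> b) - form a (b \<cdot> c + c \<cdot> b)" for a b c
  proof -
    have \<omega>_pair: "?\<omega> [:u, v:] [:w:] = [:form u w, - form v w:]" "?\<omega> [:w:] [:u, v:] = [:form w u, form w v:]"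
      for u v w
    proof -
      have "[:u, v:] = [:u:] + pCons 0 [:v:]" by simp
      then show "?\<omega> [:u, v:] [:w:] = [:form u w, - form v w:]" "?\<omega> [:w:] [:u, v:] = [:form w u, form w v:]"
        by (simp_all only: form_R_simps R_form_const[OF form]) simp_all
    qed
    show ?thesis
      unfolding I0_def I1_def
      apply (simp add: br_const R_bracket_gen_def subst_op_pCons T additive_mul_mu form_R_simps
          in_additive(1,2)[THEN additive.zero])
      apply (simp add: \<omega>_pair R_form_const[OF form] form_R_simps
          in_lam_eq in_mu_eq mul_lam_def mul_mu_def map_poly_pCons)
      by (auto simp: minus_equation_iff[of "form (b \<cdot> a) c"])
  qed
  have iff: "conformal_invariant br ?\<omega> \<longleftrightarrow> (\<forall>a b c. form (lie a b) c = form a (lie b c) \<and>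
     form (b \<cdot> a) c = - form a (b \<cdot> c + c \<cdot> b) \<and>
     form (a \<cdot> b + b \<cdot> a) c = form a (c \<cdot> b) - form a (b \<cdot> c + c \<cdot> b))"
    unfolding reduction generators ..
  have "form (a \<cdot> b + b \<cdot> a) c = form a (c \<cdot> b) - form a (b \<cdot> c + c \<cdot> b)"
    if nov: "\<And>a b c. form (a \<cdot> b) c = - form b (a \<cdot> c + c \<cdot> a)" for a b c
    using nov[of c b a] sym[of a "c \<cdot> b"] nov[of a b c] nov[of b a c] by (simp add: form_R_simps add.commute)
  then show ?thesis
    unfolding iff by blast
qed

theorem proposition4p14:
  fixes scale :: "'k::field_char_0 \<Rightarrow> 'a::ab_group_add \<Rightarrow> 'a"
    and Basis :: "'a set"
    and nov lie :: "'a \<Rightarrow> 'a \<Rightarrow> 'a"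
    and \<theta> :: 'k
    and B :: "'a poly \<Rightarrow> 'a poly"
  assumes "finite_dimensional_vector_space scale Basis"
    and "gelfand_dorfman_algebra scale nov lie"
    and "module_hom (R_act scale) (R_act scale) B"
    and "B ` range R_embed \<subseteq> range R_embed"
  shows "(rota_baxter_lie_conformal_algebra (R_act scale) (R_bracket nov lie) \<theta> B \<longleftrightarrow>
         rota_baxter_gda scale nov lie \<theta> (R_restrict B)) \<and>
         (\<forall>form. bilinear_map scale scale (*) form \<longrightarrow>
         (quadratic_rota_baxter_lie_conformal_algebra
            (R_act scale) (R_bracket nov lie) \<theta> B (R_form form) \<longleftrightarrow>
          quadratic_rota_baxter_gda scale nov lie \<theta> (R_restrict B) form))"
proof (intro conjI allI impI)
  interpret gelfand_dorfman_algebra scale nov lie by fact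
  define b where "b = R_restrict B"
  have B: "B = map_poly b" and b_linear: "Vector_Spaces.linear scale scale b"
    unfolding b_def using R_restrict_eq[OF vector_space_axioms assms(3,4)] by auto
  then have b_additive: "additive b"
    by (simp add: Vector_Spaces.linear_iff additive_def)
  have "module (R_act scale)"
    using assms(3) by (simp add: module_hom_def)
  then have conformal: "lie_conformal_algebra (R_act scale) br"
    by (rule R_lie_conformal_algebra)
  have "rota_baxter_lie_conformal_algebra (R_act scale) br \<theta> B \<longleftrightarrow>
    (\<forall>x y. br (B x) (B y) = map_poly B (br (B x) y + br x (B y) + map_poly (map_poly (scale \<theta>)) (br x y)))"
    using conformal assms(3)
    by (simp only: rota_baxter_lie_conformal_algebra_def rota_baxter_lie_conformal_algebra_axioms_def
        R_act_eqs(2)[OF vector_space_axioms] simp_thms)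
  also have "\<dots> \<longleftrightarrow> rota_baxter_identity scale \<theta> b nov \<and> rota_baxter_identity scale \<theta> b lie"
    unfolding B by (rule rota_baxter_bracket_iff[OF b_linear])
  also have "\<dots> \<longleftrightarrow> rota_baxter_gda scale nov lie \<theta> b"
    using gelfand_dorfman_algebra_axioms b_linear
    by (simp add: rota_baxter_gda_def rota_baxter_gda_axioms_def)
  finally have rota_baxter: "rota_baxter_lie_conformal_algebra (R_act scale) br \<theta> B \<longleftrightarrow>
    rota_baxter_gda scale nov lie \<theta> b" .
  then show "rota_baxter_lie_conformal_algebra (R_act scale) br \<theta> B \<longleftrightarrow>
    rota_baxter_gda scale nov lie \<theta> (R_restrict B)"
    unfolding b_def .
  fix form assume form: "bilinear_map scale scale (*) form"
  have "quadratic_rota_baxter_lie_conformal_algebra (R_act scale) br \<theta> B (R_form form) \<longleftrightarrow>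
    rota_baxter_gda scale nov lie \<theta> b \<and>
    (\<forall>a. (\<forall>b. form a b = 0) \<longrightarrow> a = 0) \<and> (\<forall>a b. form a b = form b a) \<and>
    conformal_invariant br (R_form form) \<and>
    (\<forall>u v. form (b u) v + form u (b v) + \<theta> * form u v = 0)"
    unfolding quadratic_rota_baxter_lie_conformal_algebra_def
      quadratic_rota_baxter_lie_conformal_algebra_axioms_def rota_baxter
    using conformal_bilinear_form_R_form[OF form]
    by (simp only: conformal_nondegenerate_R_form_iff[OF assms(1) form]
        conformal_symmetric_R_form_iff[OF form] R_form_rota_baxter_iff[OF form b_additive]
        B[THEN fun_cong] simp_thms)
  also have "\<dots> \<longleftrightarrow> rota_baxter_gda scale nov lie \<theta> b \<and> quadratic_gda scale nov lie form \<and>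
    (\<forall>u v. form (b u) v + form u (b v) + \<theta> * form u v = 0)"
  proof -
    have "quadratic_gda scale nov lie form \<longleftrightarrow>
      (\<forall>a. (\<forall>b. form a b = 0) \<longrightarrow> a = 0) \<and> (\<forall>a b. form a b = form b a) \<and>
      (\<forall>a b c. form (lie a b) c = form a (lie b c)) \<and>
      (\<forall>a b c. form (nov a b) c = - form b (nov a c + nov c a))"
      unfolding quadratic_gda_def quadratic_gda_axioms_def
      using form gelfand_dorfman_algebra_axioms by (simp only: simp_thms atomize_all atomize_imp) blast
    also have "\<dots> \<longleftrightarrow> (\<forall>a. (\<forall>b. form a b = 0) \<longrightarrow> a = 0) \<and> (\<forall>a b. form a b = form b a) \<and>
      conformal_invariant br (R_form form)"
      \<comment> \<open>Invariance can be compared only for a symmetric form; otherwise both sides are false.\<close>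
    proof (cases "\<forall>a b. form a b = form b a")
      case True
      then have "form a b = form b a" for a b by blast
      from conformal_invariant_R_form_iff[OF form this] show ?thesis by (simp only:)
    next
      case False
      then show ?thesis by (simp only: simp_thms)
    qed
    finally show ?thesis by (simp only: conj_assoc)
  qed
  also have "\<dots> \<longleftrightarrow> quadratic_rota_baxter_gda scale nov lie \<theta> b form"
    unfolding quadratic_rota_baxter_gda_def quadratic_rota_baxter_gda_axioms_def by (simp only: conj_assoc)
  finally show "quadratic_rota_baxter_lie_conformal_algebra (R_act scale) br \<theta> B (R_form form) \<longleftrightarrow>
    quadratic_rota_baxter_gda scale nov lie \<theta> (R_restrict B) form"
    unfolding b_def .
qed

end
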